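(* Let $G=(V,E)$ be a finite connected graph with at least one edge, and let $\mathcal{G}$ be any rooted combinatorial embedding of $G$. Then the Tutte polynomial of $G$ satisfies $$T_G(x,y)=\sum_{T \text{ spanning tree of } G} x^{\mathcal{I}(T)}\,y^{\mathcal{E}(T)},$$ where the sum is over all spanning trees $T$ of $G$ and $\mathcal{I}(T)$ (resp. $\mathcal{E}(T)$) is the number of $(\mathcal{G},T)$-active internal (resp. external) edges.
   Context: Graphs are finite and undirected; loops and multiple edges are allowed. Tutte polynomial: for a graph $G=(V,E)$, $$T_G(x,y)=\sum_{S\subseteq E}(x-1)^{c(S)-c(G)}(y-1)^{c(S)+|S|-|V|},$$ where each $S\subseteq E$ is identified with the spanning subgraph $(V,S)$, and $c(S)$, $c(G)$ denote the numbers of connected components of $(V,S)$ and of $G$. Combinatorial maps and embeddings: a combinatorial map $\mathcal{G}=(H,\sigma,\alpha)$ consists of a finite set $H$ of half-edges, a permutation $\sigma$ of $H$ and an involution $\alpha$ of $H$ without fixed points, such that the group generated by $\sigma$ and $\alpha$ acts transitively on $H$. It is rooted if one half-edge $h_0\in H$ is distinguished as the root; one then writes $\mathcal{G}=(H,\sigma,\alpha,h_0)$. The underlying graph of $\mathcal{G}$ has as vertices the cycles of $\sigma$ and as edges the cycles of $\alpha$ (so an edge is a pair $\{h,\alpha(h)\}$ of half-edges), an edge being incident to a vertex if they have at least one half-edge in common. A (rooted) combinatorial embedding of a connected graph $G$ is a (rooted) combinatorial map whose underlying graph is isomorphic to $G$; the edges of $G$ are then identified with pairs of half-edges. No planarity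 is required. Products of permutations are compositions: $\sigma\alpha(h)=\sigma(\alpha(h))$. Spanning trees: a spanning tree $T$ of $G$ is a connected acyclic spanning subgraph, identified with its edge set. An edge (or a half-edge belonging to it) is internal if the edge is in $T$, and external otherwise. The fundamental cycle of an external edge $e$ is the set of edges $f$ such that $(T\cup\{e\})\setminus\{f\}$ is a spanning tree; the fundamental cocycle of an internal edge $e$ is the set of edges $f$ such that $(T\setminus\{e\})\cup\{f\}$ is a spanning tree. (In both cases $e$ itself belongs to the set.) Motion function: given $\mathcal{G}$ and a spanning tree $T$, the motion function $t:H\to H$ is defined by $t(h)=\sigma(h)$ if $h$ is external and $t(h)=\sigma\alpha(h)$ if $h$ is internal. It is a cyclic permutation of $H$ (a single cycle containing all of $H$). $(\mathcal{G},T)$-order: for $\mathcal{G}$ with root $h_0$, the $(\mathcal{G},T)$-order on $H$ is the linear order $h_0<t(h_0)<t^2(h_0)<\cdots<t^{|H|-1}(h_0)$. The $(\mathcal{G},T)$-order on edges is the linear order defined by $\{h_1,h_2\}<\{h_1',h_2'\}$ if $\min(h_1,h_2)<\min(h_1',h_2')$. Activity: an external (resp. internal) edge is $(\mathcal{G},T)$-active (embedding-active) if it is minimal for the $(\mathcal{G},T)$-order in its fundamental cycle (resp. fundamental cocycle). *)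

theory Defs
  imports Main "HOL-Combinatorics.Orbits"
begin

section \<open>Finite multigraphs\<close>

text \<open>The set of endpoints of an edge has one element if the edge is a loop, and two otherwise.\<close>

record ('v, 'e) mgraph =
  verts :: "'v set"
  edges :: "'e set"
  ends :: "'e \<Rightarrow> 'v set"

locale multigraph =
  fixes G :: "('v, 'e) mgraph"
  assumes finite_verts: "finite (verts G)"
    and finite_edges: "finite (edges G)"
    and ends_subset: "e \<in> edges G \<Longrightarrow> ends G e \<subseteq> verts G"
    and card_ends: "e \<in> edges G \<Longrightarrow> card (ends G e) = 1 \<or> card (ends G e) = 2"

definition spanning_subgraph :: "('v, 'e) mgraph \<Rightarrow> 'e set \<Rightarrow> ('v, 'e) mgraph" where
  "spanning_subgraph G S = G\<lparr>edges := S\<rparr>"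

definition adjacency :: "('v, 'e) mgraph \<Rightarrow> ('v \<times> 'v) set" where
  "adjacency G = {(u, v). \<exists>e\<in>edges G. ends G e = {u, v}}"

definition components :: "('v, 'e) mgraph \<Rightarrow> 'v set set" where
  "components G = verts G // {(u, v) \<in> verts G \<times> verts G. (u, v) \<in> (adjacency G)\<^sup>*}"

definition num_components :: "('v, 'e) mgraph \<Rightarrow> nat" where
  "num_components G = card (components G)"

definition connected_graph :: "('v, 'e) mgraph \<Rightarrow> bool" where
  "connected_graph G \<longleftrightarrow>
     verts G \<noteq> {} \<and> (\<forall>u\<in>verts G. \<forall>v\<in>verts G. (u, v) \<in> (adjacency G)\<^sup>*)"

text \<open>A loop is a cycle of length 1, and two parallel edges form a cycle of length 2.\<close>

definition graph_cycle :: "('v, 'e) mgraph \<Rightarrow> 'v list \<Rightarrow> 'e list \<Rightarrow> bool" where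
  "graph_cycle G vs es \<longleftrightarrow>
     es \<noteq> [] \<and> length vs = length es \<and> distinct vs \<and> distinct es \<and>
     set vs \<subseteq> verts G \<and> set es \<subseteq> edges G \<and>
     (\<forall>i<length es. ends G (es ! i) = {vs ! i, vs ! (Suc i mod length es)})"

definition acyclic_graph :: "('v, 'e) mgraph \<Rightarrow> bool" where
  "acyclic_graph G \<longleftrightarrow> (\<nexists>vs es. graph_cycle G vs es)"

definition spanning_tree :: "('v, 'e) mgraph \<Rightarrow> 'e set \<Rightarrow> bool" where
  "spanning_tree G T \<longleftrightarrow>
     T \<subseteq> edges G \<and> connected_graph (spanning_subgraph G T) \<and> acyclic_graph (spanning_subgraph G T)"

text \<open>
  Evaluation of the Tutte polynomial in an arbitrary commutative ring; the polynomial itself is the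
  value at the two indeterminates of the ring of bivariate integer polynomials. On a finite
  multigraph both exponents are nonnegative, so the subtractions on natural numbers are not
  truncated.
\<close>

definition tutte :: "('v, 'e) mgraph \<Rightarrow> 'a::comm_ring_1 \<Rightarrow> 'a \<Rightarrow> 'a" where
  "tutte G x y =
     (\<Sum>S\<in>Pow (edges G).
        (x - 1) ^ (num_components (spanning_subgraph G S) - num_components G) *
        (y - 1) ^ (num_components (spanning_subgraph G S) + card S - card (verts G)))"

definition fundamental_cycle :: "('v, 'e) mgraph \<Rightarrow> 'e set \<Rightarrow> 'e \<Rightarrow> 'e set" where
  "fundamental_cycle G T e = {f \<in> edges G. spanning_tree G ((T \<union> {e}) - {f})}"

definition fundamental_cocycle :: "('v, 'e) mgraph \<Rightarrow> 'e set \<Rightarrow> 'e \<Rightarrow> 'e set" where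
  "fundamental_cocycle G T e = {f \<in> edges G. spanning_tree G ((T - {e}) \<union> {f})}"

definition graph_iso ::
  "('v \<Rightarrow> 'w) \<Rightarrow> ('e \<Rightarrow> 'f) \<Rightarrow> ('v, 'e) mgraph \<Rightarrow> ('w, 'f) mgraph \<Rightarrow> bool" where
  "graph_iso \<phi> \<psi> G G' \<longleftrightarrow>
     bij_betw \<phi> (verts G) (verts G') \<and> bij_betw \<psi> (edges G) (edges G') \<and>
     (\<forall>e\<in>edges G. ends G' (\<psi> e) = \<phi> ` ends G e)"


section \<open>Combinatorial maps\<close>

inductive_set perm_group_generated :: "('h \<Rightarrow> 'h) set \<Rightarrow> ('h \<Rightarrow> 'h) set"
  for P :: "('h \<Rightarrow> 'h) set" where
  gen_id: "id \<in> perm_group_generated P"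
| gen_base: "p \<in> P \<Longrightarrow> p \<in> perm_group_generated P"
| gen_inv: "p \<in> perm_group_generated P \<Longrightarrow> inv p \<in> perm_group_generated P"
| gen_comp: "p \<in> perm_group_generated P \<Longrightarrow> q \<in> perm_group_generated P \<Longrightarrow>
    p \<circ> q \<in> perm_group_generated P"

record 'h cmap =
  half_edges :: "'h set"
  sigma :: "'h \<Rightarrow> 'h"
  alpha :: "'h \<Rightarrow> 'h"

record 'h rooted_cmap = "'h cmap" +
  root :: 'h

locale combinatorial_map =
  fixes M :: "('h, 'z) cmap_scheme"
  assumes finite_half_edges: "finite (half_edges M)"
    and sigma_permutes: "sigma M permutes half_edges M"
    and alpha_permutes: "alpha M permutes half_edges M"
    and alpha_involution: "h \<in> half_edges M \<Longrightarrow> alpha M (alpha M h) = h"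
    and alpha_no_fixpoint: "h \<in> half_edges M \<Longrightarrow> alpha M h \<noteq> h"
    and transitive: "h \<in> half_edges M \<Longrightarrow> h' \<in> half_edges M \<Longrightarrow>
      \<exists>p\<in>perm_group_generated {sigma M, alpha M}. p h = h'"

locale rooted_combinatorial_map = combinatorial_map M
  for M :: "('h, 'z) rooted_cmap_scheme" +
  assumes root_in: "root M \<in> half_edges M"

text \<open>Cycles of permutations are represented by their supporting sets, i.e. by orbits.\<close>

definition underlying_graph :: "('h, 'z) cmap_scheme \<Rightarrow> ('h set, 'h set) mgraph" where
  "underlying_graph M =
     \<lparr>verts = orbit (sigma M) ` half_edges M,
      edges = orbit (alpha M) ` half_edges M,
      ends = (\<lambda>e. {v \<in> orbit (sigma M) ` half_edges M. v \<inter> e \<noteq> {}})\<rparr>"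

text \<open>
  The isomorphism is part of the data: \<open>\<psi>\<close> is the identification of the edges of the graph with
  pairs of half-edges.
\<close>

definition rooted_embedding ::
  "('v, 'e) mgraph \<Rightarrow> 'h rooted_cmap \<Rightarrow> ('v \<Rightarrow> 'h set) \<Rightarrow> ('e \<Rightarrow> 'h set) \<Rightarrow> bool" where
  "rooted_embedding G M \<phi> \<psi> \<longleftrightarrow>
     rooted_combinatorial_map M \<and> graph_iso \<phi> \<psi> G (underlying_graph M)"


section \<open>Embedding activities\<close>

text \<open>Below, \<open>T\<close> is a spanning tree of the underlying graph, hence a set of pairs of half-edges.\<close>

definition internal_half_edge :: "('h, 'z) cmap_scheme \<Rightarrow> 'h set set \<Rightarrow> 'h \<Rightarrow> bool" where
  "internal_half_edge M T h \<longleftrightarrow> orbit (alpha M) h \<in> T"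

definition motion :: "('h, 'z) cmap_scheme \<Rightarrow> 'h set set \<Rightarrow> 'h \<Rightarrow> 'h" where
  "motion M T h = (if internal_half_edge M T h then sigma M (alpha M h) else sigma M h)"

text \<open>
  The position of \<open>h\<close> in the sequence \<open>h\<^sub>0, t h\<^sub>0, t (t h\<^sub>0), \<dots>\<close>. The motion function
  \<open>t\<close> of a spanning tree is a single cycle on the half-edges, so every half-edge occurs.
\<close>

definition half_edge_pos :: "('h, 'z) rooted_cmap_scheme \<Rightarrow> 'h set set \<Rightarrow> 'h \<Rightarrow> nat" where
  "half_edge_pos M T h = (LEAST i. (motion M T ^^ i) (root M) = h)"

definition half_edge_less :: "('h, 'z) rooted_cmap_scheme \<Rightarrow> 'h set set \<Rightarrow> 'h \<Rightarrow> 'h \<Rightarrow> bool" where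
  "half_edge_less M T h h' \<longleftrightarrow> half_edge_pos M T h < half_edge_pos M T h'"

definition min_half_edge :: "('h, 'z) rooted_cmap_scheme \<Rightarrow> 'h set set \<Rightarrow> 'h set \<Rightarrow> 'h" where
  "min_half_edge M T e = arg_min_on (half_edge_pos M T) e"

definition edge_less ::
  "('h, 'z) rooted_cmap_scheme \<Rightarrow> 'h set set \<Rightarrow> 'h set \<Rightarrow> 'h set \<Rightarrow> bool" where
  "edge_less M T e e' \<longleftrightarrow> half_edge_less M T (min_half_edge M T e) (min_half_edge M T e')"

definition minimal_edge_in ::
  "('h, 'z) rooted_cmap_scheme \<Rightarrow> 'h set set \<Rightarrow> 'h set set \<Rightarrow> 'h set \<Rightarrow> bool" where
  "minimal_edge_in M T C e \<longleftrightarrow> e \<in> C \<and> (\<forall>f\<in>C. f \<noteq> e \<longrightarrow> edge_less M T e f)"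

definition internal_activity :: "('h, 'z) rooted_cmap_scheme \<Rightarrow> 'h set set \<Rightarrow> nat" where
  "internal_activity M T =
     card {e \<in> T. minimal_edge_in M T (fundamental_cocycle (underlying_graph M) T e) e}"

definition external_activity :: "('h, 'z) rooted_cmap_scheme \<Rightarrow> 'h set set \<Rightarrow> nat" where
  "external_activity M T =
     card {e \<in> edges (underlying_graph M) - T.
             minimal_edge_in M T (fundamental_cycle (underlying_graph M) T e) e}"

end

theory Submission
  imports Defs
begin

text \<open>
  Follow the tour of a spanning tree \<open>T\<close> backwards from the root. Which edge is met next for the
  first time depends only on which of the edges met so far belong to \<open>T\<close>, so the edges are processed
  by a decision tree, and the Tutte sum over all \<open>S\<close> with \<open>A \<subseteq> S \<subseteq> E - B\<close> can be computed by
  contracting (\<open>A\<close>) or deleting (\<open>B\<close>) the next edge. An edge contributes a factor \<open>x\<close> (\<open>y\<close>) if it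
  has become a bridge (loop) when it is met, that is, if it comes last in its fundamental cocycle
  (cycle) for the order of first backward visits, equivalently if its larger half-edge is smaller
  than those of the other edges of the cocycle (cycle). Finally, the half-edges of an internal edge
  \<open>f\<close> separate those of an external edge \<open>e\<close> on the tour whenever \<open>e\<close> and \<open>f\<close> can be exchanged.
  For two such edges, comparing the larger half-edges gives the same result as comparing the smaller
  ones, so this activity is the embedding activity.
\<close>

section \<open>Connectivity and forests\<close>

lemma adjacency_spanning_subgraph:
  "adjacency (spanning_subgraph G S) = {(u, v). \<exists>e\<in>S. ends G e = {u, v}}"
  by (simp add: adjacency_def spanning_subgraph_def)

text \<open>The relation lives on the whole vertex type, so it is an equivalence without side
  conditions; it is restricted to \<open>verts G\<close> only when components are counted.\<close>

definition linked :: "('v, 'e) mgraph \<Rightarrow> 'e set \<Rightarrow> ('v \<times> 'v) set" where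
  "linked G S = (adjacency (spanning_subgraph G S))\<^sup>*"

definition nc :: "('v, 'e) mgraph \<Rightarrow> 'e set \<Rightarrow> nat" where
  "nc G S = num_components (spanning_subgraph G S)"

text \<open>Membership of \<open>e\<close> in the closure of \<open>S\<close> in the cycle matroid.\<close>

definition spans :: "('v, 'e) mgraph \<Rightarrow> 'e set \<Rightarrow> 'e \<Rightarrow> bool" where
  "spans G S e \<longleftrightarrow> (\<forall>u\<in>ends G e. \<forall>v\<in>ends G e. (u, v) \<in> linked G S)"

text \<open>Independence in the cycle matroid, which suits induction on edge sets better than the
  absence of cycles; \<open>acyclic_iff_forest\<close> proves the two equivalent.\<close>

definition forest :: "('v, 'e) mgraph \<Rightarrow> 'e set \<Rightarrow> bool" where
  "forest G S \<longleftrightarrow> (\<forall>e\<in>S. \<not> spans G (S - {e}) e)"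

lemma linked_refl [simp]: "(u, u) \<in> linked G S"
  by (simp add: linked_def)

lemma linked_trans: "(u, v) \<in> linked G S \<Longrightarrow> (v, w) \<in> linked G S \<Longrightarrow> (u, w) \<in> linked G S"
  by (simp add: linked_def)

lemma linked_sym: "(u, v) \<in> linked G S \<Longrightarrow> (v, u) \<in> linked G S"
proof -
  have "sym (adjacency (spanning_subgraph G S))"
    unfolding adjacency_spanning_subgraph by (auto simp: sym_def insert_commute)
  then show "(u, v) \<in> linked G S \<Longrightarrow> (v, u) \<in> linked G S"
    unfolding linked_def by (meson sym_rtrancl symD)
qed

lemma linked_edge: "e \<in> S \<Longrightarrow> ends G e = {u, v} \<Longrightarrow> (u, v) \<in> linked G S"
  unfolding linked_def adjacency_spanning_subgraph by blast

lemma linked_mono: "S \<subseteq> S' \<Longrightarrow> linked G S \<subseteq> linked G S'"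
  unfolding linked_def adjacency_spanning_subgraph by (rule rtrancl_mono) blast

lemma linked_empty: "linked G {} = Id"
  by (simp add: linked_def adjacency_spanning_subgraph)

text \<open>Every edge of a path in \<open>S'\<close> can be replaced by a path in
  \<open>S\<close>.\<close>

lemma linked_closure:
  assumes "\<And>e. e \<in> S' \<Longrightarrow> spans G S e"
  shows "linked G S' \<subseteq> linked G S"
proof -
  have "adjacency (spanning_subgraph G S') \<subseteq> linked G S"
    using assms unfolding adjacency_spanning_subgraph spans_def by blast
  then show ?thesis
    unfolding linked_def by (metis rtrancl_idemp rtrancl_mono)
qed

lemma spans_mono: "spans G S e \<Longrightarrow> S \<subseteq> S' \<Longrightarrow> spans G S' e"
  unfolding spans_def using linked_mono by blast

lemma spans_iff: "ends G e = {u, v} \<Longrightarrow> spans G S e \<longleftrightarrow> (u, v) \<in> linked G S"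
  unfolding spans_def by (auto intro: linked_sym)

text \<open>A path can be shortened until it uses \<open>e\<close> at most once, in one of the two
  directions.\<close>

lemma linked_insert:
  assumes "ends G e = {u, v}"
  shows "(p, q) \<in> linked G (insert e S) \<longleftrightarrow> (p, q) \<in> linked G S \<or>
    (p, u) \<in> linked G S \<and> (v, q) \<in> linked G S \<or> (p, v) \<in> linked G S \<and> (u, q) \<in> linked G S"
proof
  \<comment> \<open>The undirected edge contributes two ordered pairs to the adjacency relation, so
    \<open>rtrancl_insert\<close> is applied twice below.\<close>
  have *: "linked G (insert e S) = (insert (u, v) (insert (v, u) (adjacency (spanning_subgraph G S))))\<^sup>*"
    unfolding linked_def adjacency_spanning_subgraph using assms
    by (intro arg_cong[where f = rtrancl]) (auto simp: doubleton_eq_iff)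
  assume "(p, q) \<in> linked G (insert e S)"
  then show "(p, q) \<in> linked G S \<or>
    (p, u) \<in> linked G S \<and> (v, q) \<in> linked G S \<or> (p, v) \<in> linked G S \<and> (u, q) \<in> linked G S"
    unfolding * rtrancl_insert linked_def[symmetric] by (auto intro: linked_trans)
next
  have "(u, v) \<in> linked G (insert e S)"
    using assms by (intro linked_edge) auto
  moreover have "linked G S \<subseteq> linked G (insert e S)"
    by (rule linked_mono) blast
  ultimately show "(p, q) \<in> linked G S \<or>
    (p, u) \<in> linked G S \<and> (v, q) \<in> linked G S \<or> (p, v) \<in> linked G S \<and> (u, q) \<in> linked G S \<Longrightarrow>
    (p, q) \<in> linked G (insert e S)"
    by (meson linked_sym linked_trans subsetD)
qed

lemma forest_subset: "forest G S \<Longrightarrow> S' \<subseteq> S \<Longrightarrow> forest G S'"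
  unfolding forest_def by (meson Diff_mono order_refl spans_mono subsetD)

context multigraph
begin

lemma ends_eq:
  assumes "e \<in> edges G"
  obtains u v where "ends G e = {u, v}" "u \<in> verts G" "v \<in> verts G"
proof -
  consider x where "ends G e = {x}" | x y where "ends G e = {x, y}"
    using card_ends[OF assms] by (metis card_1_singletonE card_2_iff)
  then show ?thesis
    using that ends_subset[OF assms] by cases auto
qed

lemma spans_self: "e \<in> S \<Longrightarrow> e \<in> edges G \<Longrightarrow> spans G S e"
  using ends_eq[of e] by (metis linked_edge spans_iff)

lemma finite_subset_edges: "S \<subseteq> edges G \<Longrightarrow> finite S"
  using finite_edges finite_subset by blast

section \<open>Counting components\<close>

lemma nc_eq: "nc G S = card (verts G // {(u, v) \<in> verts G \<times> verts G. (u, v) \<in> linked G S})"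
  unfolding nc_def num_components_def components_def linked_def by (simp add: spanning_subgraph_def)

lemma nc_eq_UN: "nc G S = card ((\<lambda>u. {v \<in> verts G. (u, v) \<in> linked G S}) ` verts G)"
  unfolding nc_eq quotient_def
  by (rule arg_cong[where f = card]) (auto simp: image_def)

lemma nc_cong:
  "(\<And>u v. u \<in> verts G \<Longrightarrow> v \<in> verts G \<Longrightarrow> (u, v) \<in> linked G S \<longleftrightarrow> (u, v) \<in> linked G S') \<Longrightarrow>
    nc G S = nc G S'"
  unfolding nc_eq by (rule arg_cong[where f = card]) (rule arg_cong2[where f = quotient], auto)

lemma nc_empty: "nc G {} = card (verts G)"
proof -
  have "(\<lambda>u. {v \<in> verts G. (u, v) \<in> linked G {}}) ` verts G = (\<lambda>u. {u}) ` verts G"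
    unfolding linked_empty by (rule image_cong) auto
  then show ?thesis
    unfolding nc_eq_UN by (simp add: card_image)
qed

lemma nc_pos: "verts G \<noteq> {} \<Longrightarrow> nc G S \<ge> 1"
  unfolding nc_eq_UN using finite_verts by (simp add: Suc_le_eq card_gt_0_iff)

lemma nc_insert_spans:
  assumes "spans G S e" "e \<in> edges G"
  shows "nc G (insert e S) = nc G S"
proof (rule nc_cong)
  obtain p q where pq: "ends G e = {p, q}"
    using ends_eq[OF assms(2)] .
  with assms(1) have "(p, q) \<in> linked G S"
    by (simp add: spans_iff)
  then show "(u, v) \<in> linked G (insert e S) \<longleftrightarrow> (u, v) \<in> linked G S" for u v
    unfolding linked_insert[OF pq] by (meson linked_sym linked_trans)
qed

text \<open>The classes of the two ends of \<open>e\<close> are distinct and get merged. In the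
  proof, \<open>C\<close> and \<open>D\<close> are the classes before and after the insertion, and
  \<open>W\<close> collects the vertices whose class stays the same.\<close>

lemma nc_insert_not_spans:
  assumes "\<not> spans G S e" "e \<in> edges G"
  shows "Suc (nc G (insert e S)) = nc G S"
proof -
  obtain p q where pq: "ends G e = {p, q}" "p \<in> verts G" "q \<in> verts G"
    using ends_eq[OF assms(2)] .
  with assms(1) have not: "(p, q) \<notin> linked G S"
    by (simp add: spans_iff)
  define C where "C u = {v \<in> verts G. (u, v) \<in> linked G S}" for u
  define D where "D u = {v \<in> verts G. (u, v) \<in> linked G (insert e S)}" for u
  have C_eq: "C u = C v \<longleftrightarrow> (u, v) \<in> linked G S" if "u \<in> verts G" "v \<in> verts G" for u v
    using that unfolding C_def by (auto intro: linked_sym linked_trans)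
  have D1: "D u = C p \<union> C q" if "u \<in> verts G" "(u, p) \<in> linked G S \<or> (u, q) \<in> linked G S" for u
    using that unfolding D_def C_def linked_insert[OF pq(1)]
    by (auto intro: linked_sym linked_trans)
  have D2: "D u = C u" if "u \<in> verts G" "(u, p) \<notin> linked G S" "(u, q) \<notin> linked G S" for u
    using that unfolding D_def C_def linked_insert[OF pq(1)] by auto
  define W where "W = {u \<in> verts G. (u, p) \<notin> linked G S \<and> (u, q) \<notin> linked G S}"
  have "C ` verts G = insert (C p) (insert (C q) (C ` W))"
  proof -
    have "C u \<in> insert (C p) (insert (C q) (C ` W))" if "u \<in> verts G" for u
      using that pq C_eq[of u] unfolding W_def by blast
    then show ?thesis
      using pq unfolding W_def by blast
  qed
  moreover have "C p \<noteq> C q" "C p \<notin> C ` W" "C q \<notin> C ` W"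
    using pq C_eq not unfolding W_def by (auto dest: linked_sym)
  moreover have "finite W"
    unfolding W_def using finite_verts by auto
  ultimately have 1: "card (C ` verts G) = Suc (Suc (card (C ` W)))"
    by simp
  have "D ` verts G = insert (C p \<union> C q) (C ` W)"
  proof
    show "D ` verts G \<subseteq> insert (C p \<union> C q) (C ` W)"
    proof (rule image_subsetI)
      fix u assume "u \<in> verts G"
      then show "D u \<in> insert (C p \<union> C q) (C ` W)"
        using D1[of u] D2[of u] unfolding W_def by blast
    qed
    have "D p = C p \<union> C q"
      using D1[of p] pq by auto
    moreover have "C ` W \<subseteq> D ` verts G"
      using D2 unfolding W_def by force
    ultimately show "insert (C p \<union> C q) (C ` W) \<subseteq> D ` verts G"
      using pq by (metis imageI insert_subset)
  qed
  moreover have "C p \<union> C q \<notin> C ` W"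
    using pq unfolding W_def by (auto simp: C_def set_eq_iff dest: linked_sym)
  ultimately have "card (D ` verts G) = Suc (card (C ` W))"
    using \<open>finite W\<close> by simp
  with 1 show ?thesis
    unfolding nc_eq_UN C_def D_def by simp
qed

text \<open>Without edges every vertex is a component, and each new edge lowers the count by at most
  one. This keeps the second exponent of the Tutte polynomial from being truncated.\<close>

lemma nc_card_ge:
  assumes "S \<subseteq> edges G"
  shows "card (verts G) \<le> nc G S + card S"
  using finite_subset_edges[OF assms] assms
proof (induction S rule: finite_induct)
  case (insert e S)
  then show ?case
    using nc_insert_spans[of S e] nc_insert_not_spans[of S e] by (cases "spans G S e") auto
qed (simp add: nc_empty)

text \<open>Equality in \<open>nc_card_ge\<close> means that each inserted edge merges two
  components. An edge spanned by the others could be removed at no change of \<open>nc\<close>, and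
  the bound would then fail for the rest.\<close>

lemma forest_iff_card:
  assumes "S \<subseteq> edges G"
  shows "forest G S \<longleftrightarrow> nc G S + card S = card (verts G)"
proof
  show "forest G S \<Longrightarrow> nc G S + card S = card (verts G)"
    using finite_subset_edges[OF assms] assms
  proof (induction S rule: finite_induct)
    case (insert e S)
    moreover from insert have "forest G S"
      by (meson forest_subset subset_insertI)
    moreover from insert have "\<not> spans G S e"
      unfolding forest_def by simp
    ultimately show ?case
      using nc_insert_not_spans[of S e] by auto
  qed (simp add: nc_empty)
next
  assume eq: "nc G S + card S = card (verts G)"
  show "forest G S"
    unfolding forest_def
  proof (intro ballI notI)
    fix e assume e: "e \<in> S" "spans G (S - {e}) e"
    then have "nc G S = nc G (S - {e})"
      using nc_insert_spans[of "S - {e}" e] assms by (auto simp: insert_absorb)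
    moreover have "card S = Suc (card (S - {e}))"
      using e finite_subset_edges[OF assms] by (metis card_Suc_Diff1)
    ultimately show False
      using eq nc_card_ge[of "S - {e}"] assms by auto
  qed
qed

lemma forest_insert:
  assumes "forest G S" "\<not> spans G S e" "insert e S \<subseteq> edges G"
  shows "forest G (insert e S)"
proof -
  have "e \<notin> S"
    using assms spans_self by blast
  then show ?thesis
    using assms nc_insert_not_spans[of S e] forest_iff_card[of S] forest_iff_card[of "insert e S"]
      finite_subset_edges[of S] by auto
qed

lemma nc_eq_1_iff:
  "nc G S = 1 \<longleftrightarrow> verts G \<noteq> {} \<and> (\<forall>u\<in>verts G. \<forall>v\<in>verts G. (u, v) \<in> linked G S)"
proof
  assume "nc G S = 1"
  define f where "f u = {v \<in> verts G. (u, v) \<in> linked G S}" for u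
  from \<open>nc G S = 1\<close> obtain X where X: "f ` verts G = {X}"
    unfolding nc_eq_UN f_def by (rule card_1_singletonE)
  have "(u, v) \<in> linked G S" if "u \<in> verts G" "v \<in> verts G" for u v
  proof -
    have "f u = f v"
      using X that by blast
    moreover have "v \<in> f v"
      using that by (simp add: f_def)
    ultimately have "v \<in> f u"
      by simp
    then show ?thesis
      by (simp add: f_def)
  qed
  moreover have "verts G \<noteq> {}"
    using X by auto
  ultimately show "verts G \<noteq> {} \<and> (\<forall>u\<in>verts G. \<forall>v\<in>verts G. (u, v) \<in> linked G S)"
    by blast
next
  assume "verts G \<noteq> {} \<and> (\<forall>u\<in>verts G. \<forall>v\<in>verts G. (u, v) \<in> linked G S)"
  then have "(\<lambda>u. {v \<in> verts G. (u, v) \<in> linked G S}) ` verts G = {verts G}"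
    by auto
  then show "nc G S = 1"
    unfolding nc_eq_UN by simp
qed

lemma connected_iff: "connected_graph (spanning_subgraph G S) \<longleftrightarrow> nc G S = 1"
  unfolding nc_eq_1_iff connected_graph_def linked_def by (simp add: spanning_subgraph_def)

lemma nc_1_mono:
  assumes "nc G S = 1" "linked G S \<subseteq> linked G S'"
  shows "nc G S' = 1"
  using assms unfolding nc_eq_1_iff by blast

lemma nc_1_remove:
  assumes "nc G S = 1" "spans G (S - {e}) e" "S \<subseteq> edges G"
  shows "nc G (S - {e}) = 1"
  using assms(1)
proof (rule nc_1_mono, intro linked_closure)
  show "spans G (S - {e}) f" if "f \<in> S" for f
    using that assms(2,3) spans_self[of f "S - {e}"] by (cases "f = e") auto
qed

section \<open>Forests are the acyclic edge sets\<close>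

lemma simple_path_if_linked:
  assumes "(u, v) \<in> linked G S" "u \<in> verts G" "S \<subseteq> edges G"
  shows "\<exists>vs es. length vs = Suc (length es) \<and> vs ! 0 = u \<and> vs ! length es = v \<and> distinct vs \<and>
    set vs \<subseteq> verts G \<and> set es \<subseteq> S \<and> (\<forall>i<length es. ends G (es ! i) = {vs ! i, vs ! Suc i})"
  using assms(1) unfolding linked_def
proof (induction rule: rtrancl_induct)
  case base
  show ?case
    using assms(2) by (intro exI[of _ "[u]"] exI[of _ "[]"]) simp
next
  case (step v w)
  from step.IH obtain vs es where IH: "length vs = Suc (length es)" "vs ! 0 = u" "vs ! length es = v"
    "distinct vs" "set vs \<subseteq> verts G" "set es \<subseteq> S" "\<forall>i<length es. ends G (es ! i) = {vs ! i, vs ! Suc i}"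
    by blast
  from step.hyps(2) obtain e where e: "e \<in> S" "ends G e = {v, w}"
    unfolding adjacency_spanning_subgraph by auto
  show ?case
  proof (cases "w \<in> set vs")
    case True
    then obtain k where k: "k < length vs" "vs ! k = w"
      by (auto simp: in_set_conv_nth)
    \<comment> \<open>The walk returns to a vertex already visited, so the path is cut at that
      earlier visit.\<close>
    with IH show ?thesis
      by (intro exI[of _ "take (Suc k) vs"] exI[of _ "take k es"])
        (auto simp: min_def le_less_Suc_eq dest!: in_set_takeD)
  next
    case False
    moreover have "w \<in> verts G"
      using e assms(3) ends_subset[of e] by auto
    ultimately show ?thesis
      using IH e by (intro exI[of _ "vs @ [w]"] exI[of _ "es @ [e]"])
        (auto simp: nth_append less_Suc_eq)
  qed
qed

text \<open>A simple path that joins the ends of \<open>e\<close> and avoids \<open>e\<close> is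
  closed to a cycle by \<open>e\<close>. If \<open>e\<close> is a loop, the path has no
  edges.\<close>

lemma not_acyclic_if_spans:
  assumes e: "e \<in> S" "spans G (S - {e}) e" and S: "S \<subseteq> edges G"
  shows "\<not> acyclic_graph (spanning_subgraph G S)"
proof -
  obtain u v where uv: "ends G e = {u, v}" "u \<in> verts G" "v \<in> verts G"
    using ends_eq[of e] e S by blast
  then have "(u, v) \<in> linked G (S - {e})"
    using e by (simp add: spans_iff)
  from simple_path_if_linked[OF this uv(2)] S
  obtain vs es where p: "length vs = Suc (length es)" "vs ! 0 = u" "vs ! length es = v" "distinct vs"
    "set vs \<subseteq> verts G" "set es \<subseteq> S - {e}" "\<forall>i<length es. ends G (es ! i) = {vs ! i, vs ! Suc i}"
    by blast
  \<comment> \<open>Equal edges have equal end pairs, and since the vertices are distinct, their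
    positions agree or each is the successor of the other, which is impossible.\<close>
  have "distinct es"
    unfolding distinct_conv_nth
  proof (intro allI impI notI)
    fix i j assume ij: "i < length es" "j < length es" "i \<noteq> j" "es ! i = es ! j"
    then have "{vs ! i, vs ! Suc i} = {vs ! j, vs ! Suc j}"
      using p(7) by metis
    then have "vs ! i = vs ! j \<and> vs ! Suc i = vs ! Suc j \<or> vs ! i = vs ! Suc j \<and> vs ! Suc i = vs ! j"
      by (simp add: doubleton_eq_iff)
    then show False
      using ij p(1,4) by (auto simp: nth_eq_iff_index_eq)
  qed
  have "graph_cycle (spanning_subgraph G S) vs (es @ [e])"
    unfolding graph_cycle_def
  proof (intro conjI allI impI)
    fix i assume "i < length (es @ [e])"
    then consider "i < length es" | "i = length es"
      by fastforce
    then show "ends (spanning_subgraph G S) ((es @ [e]) ! i) = {vs ! i, vs ! (Suc i mod length (es @ [e]))}"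
      using p uv by cases (auto simp: spanning_subgraph_def nth_append)
  qed (use p e S \<open>distinct es\<close> in \<open>auto simp: spanning_subgraph_def\<close>)
  then show ?thesis
    unfolding acyclic_graph_def by blast
qed

lemma acyclic_iff_forest:
  assumes "S \<subseteq> edges G"
  shows "acyclic_graph (spanning_subgraph G S) \<longleftrightarrow> forest G S"
proof
  show "acyclic_graph (spanning_subgraph G S) \<Longrightarrow> forest G S"
    unfolding forest_def using not_acyclic_if_spans assms by blast
next
  assume F: "forest G S"
  show "acyclic_graph (spanning_subgraph G S)"
    unfolding acyclic_graph_def
  proof (intro notI, elim exE)
    fix vs es assume "graph_cycle (spanning_subgraph G S) vs es"
    then have c: "es \<noteq> []" "length vs = length es" "distinct es" "set es \<subseteq> S"
      "\<And>i. i < length es \<Longrightarrow> ends G (es ! i) = {vs ! i, vs ! (Suc i mod length es)}"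
      unfolding graph_cycle_def by (auto simp: spanning_subgraph_def)
    let ?n = "length es" and ?e = "es ! 0"
    \<comment> \<open>The rest of the cycle bypasses its first edge. Writing \<open>1 mod ?n\<close>
      for the start includes the cycle of length 1, where the start is
      \<open>vs ! 0\<close>.\<close>
    have "(vs ! (1 mod ?n), vs ! (Suc k mod ?n)) \<in> linked G (S - {?e})" if "k < ?n" for k
      using that
    proof (induction k)
      case (Suc k)
      have "es ! Suc k \<noteq> ?e"
        using c Suc.prems by (simp add: nth_eq_iff_index_eq)
      then have "(vs ! (Suc k), vs ! (Suc (Suc k) mod ?n)) \<in> linked G (S - {?e})"
        using c Suc.prems nth_mem[of "Suc k" es] by (intro linked_edge[of "es ! Suc k"]) auto
      with Suc show ?case
        by (auto intro: linked_trans)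
    qed simp
    from this[of "?n - 1"] have "(vs ! (1 mod ?n), vs ! 0) \<in> linked G (S - {?e})"
      using c(1) by simp
    moreover have "ends G ?e = {vs ! 0, vs ! (1 mod ?n)}"
      using c(1,5) by simp
    ultimately have "spans G (S - {?e}) ?e"
      using linked_sym by (fastforce simp: spans_iff)
    moreover have "?e \<in> S"
      using c by (metis length_greater_0_conv nth_mem subsetD)
    ultimately show False
      using F unfolding forest_def by blast
  qed
qed

section \<open>Spanning trees as bases\<close>

lemma spanning_tree_iff:
  "spanning_tree G T \<longleftrightarrow> T \<subseteq> edges G \<and> forest G T \<and> nc G T = 1"
  unfolding spanning_tree_def using acyclic_iff_forest connected_iff by blast

lemma spanning_tree_iff_card:
  "spanning_tree G T \<longleftrightarrow> T \<subseteq> edges G \<and> nc G T = 1 \<and> Suc (card T) = card (verts G)"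
  unfolding spanning_tree_iff using forest_iff_card by auto

text \<open>A maximal forest between \<open>A\<close> and \<open>S\<close> spans every edge of
  \<open>S\<close>, so it is as connected as \<open>S\<close>.\<close>

lemma spanning_tree_extension:
  assumes "forest G A" "A \<subseteq> S" "S \<subseteq> edges G" "nc G S = 1"
  obtains T where "spanning_tree G T" "A \<subseteq> T" "T \<subseteq> S"
proof -
  let ?P = "\<lambda>F. forest G F \<and> A \<subseteq> F \<and> F \<subseteq> S"
  have "finite {F. ?P F}"
    by (rule finite_subset[of _ "Pow S"]) (use finite_subset_edges[OF assms(3)] in auto)
  then obtain F where "F \<in> {F. ?P F}" and max: "\<forall>F'\<in>{F. ?P F}. F \<subseteq> F' \<longrightarrow> F = F'"
    using finite_has_maximal2[of "{F. ?P F}" A] assms by blast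
  then have F: "?P F"
    by blast
  have "spans G F e" if "e \<in> S" for e
  proof (rule ccontr)
    assume not: "\<not> spans G F e"
    then have "?P (insert e F)"
      using F that assms(3) forest_insert[of F e] by auto
    then have "e \<in> F"
      using max by blast
    with not show False
      using spans_self that assms(3) by blast
  qed
  then have "linked G S \<subseteq> linked G F"
    by (rule linked_closure)
  with assms(4) have "nc G F = 1"
    by (rule nc_1_mono)
  with F assms(3) that show thesis
    unfolding spanning_tree_iff by blast
qed

end

section \<open>Activities with respect to tree-dependent orders\<close>

text \<open>Active edges are ranked last, not first, in their cocycle or cycle: an edge met when
  everything else there has been decided is a bridge or a loop.\<close>

definition internally_active :: "('v, 'e) mgraph \<Rightarrow> ('e set \<Rightarrow> 'e \<Rightarrow> nat) \<Rightarrow> 'e set \<Rightarrow> 'e set" where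
  "internally_active G r T = {e \<in> T. \<forall>f\<in>fundamental_cocycle G T e. f \<noteq> e \<longrightarrow> r T f < r T e}"

definition externally_active :: "('v, 'e) mgraph \<Rightarrow> ('e set \<Rightarrow> 'e \<Rightarrow> nat) \<Rightarrow> 'e set \<Rightarrow> 'e set" where
  "externally_active G r T = {e \<in> edges G - T. \<forall>f\<in>fundamental_cycle G T e. f \<noteq> e \<longrightarrow> r T f < r T e}"

text \<open>The sum is split by whether \<open>e\<close> belongs to \<open>S\<close>. The predicate
  \<open>P\<close> lets the same lemma serve for all edge sets and for spanning trees.\<close>

lemma sum_interval_insert:
  fixes w :: "'e set \<Rightarrow> 'a::comm_monoid_add"
  assumes "finite X" "e \<in> X" "e \<notin> A" "e \<notin> B" "A \<subseteq> X" "B \<subseteq> X"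
  shows "(\<Sum>S | A \<subseteq> S \<and> S \<subseteq> X - B \<and> P S. w S) =
    (\<Sum>S | insert e A \<subseteq> S \<and> S \<subseteq> X - B \<and> P S. w S) + (\<Sum>S | A \<subseteq> S \<and> S \<subseteq> X - insert e B \<and> P S. w S)"
proof -
  have fin: "finite {S. A' \<subseteq> S \<and> S \<subseteq> X - B' \<and> P S}" for A' B'
    by (rule finite_subset[of _ "Pow X"]) (use assms(1) in auto)
  have "{S. A \<subseteq> S \<and> S \<subseteq> X - B \<and> P S} =
      {S. insert e A \<subseteq> S \<and> S \<subseteq> X - B \<and> P S} \<union> {S. A \<subseteq> S \<and> S \<subseteq> X - insert e B \<and> P S}"
    using assms by blast
  then show ?thesis
    using fin by (simp only:) (rule sum.union_disjoint, auto)
qed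

lemma sum_interval_reindex:
  assumes "e \<in> X" "e \<notin> A" "e \<notin> B"
  shows "(\<Sum>S | insert e A \<subseteq> S \<and> S \<subseteq> X - B. w S) = (\<Sum>S | A \<subseteq> S \<and> S \<subseteq> X - insert e B. w (insert e S))"
proof (rule sum.reindex_bij_witness[of _ "insert e" "\<lambda>S. S - {e}"])
qed (use assms in \<open>auto simp: insert_absorb\<close>)

context multigraph
begin

section \<open>Exchange of edges\<close>

lemma spanning_tree_not_spans:
  assumes "spanning_tree G T" "A \<subseteq> T" "e \<in> T" "e \<notin> A"
  shows "\<not> spans G A e"
  using assms spans_mono[of G A e "T - {e}"] unfolding spanning_tree_iff forest_def by blast

lemma spans_if_spanning_tree_avoids:
  assumes "spanning_tree G T" "T \<subseteq> S - {e}" "e \<in> edges G"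
  shows "spans G (S - {e}) e"
proof -
  obtain u v where "ends G e = {u, v}" "u \<in> verts G" "v \<in> verts G"
    using ends_eq[OF assms(3)] .
  moreover have "nc G T = 1"
    using assms(1) by (simp add: spanning_tree_iff)
  ultimately have "spans G T e"
    unfolding nc_eq_1_iff by (simp add: spans_iff)
  then show ?thesis
    using assms(2) by (rule spans_mono)
qed

text \<open>If \<open>f\<close> were in \<open>T\<close>, the exchange would leave the tree
  \<open>T - {e}\<close>, which would span \<open>e\<close> although \<open>T\<close> is a
  forest.\<close>

lemma fundamental_cocycle_external:
  assumes "spanning_tree G T" "e \<in> T" "f \<in> fundamental_cocycle G T e" "f \<noteq> e"
  shows "f \<notin> T"
proof
  assume "f \<in> T"
  then have "T - {e} \<union> {f} = T - {e}"
    using assms by blast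
  then have "spanning_tree G (T - {e})"
    using assms(3) by (simp add: fundamental_cocycle_def)
  then have "spans G (T - {e}) e"
    by (rule spans_if_spanning_tree_avoids) (use assms in \<open>auto simp: spanning_tree_def\<close>)
  then show False
    using assms(1,2) unfolding spanning_tree_iff forest_def by blast
qed

lemma fundamental_cycle_internal:
  assumes "spanning_tree G T" "e \<in> edges G - T" "f \<in> fundamental_cycle G T e" "f \<noteq> e"
  shows "f \<in> T"
proof (rule ccontr)
  assume "f \<notin> T"
  then have "T \<union> {e} - {f} = insert e T"
    using assms by blast
  then have "spanning_tree G (insert e T)"
    using assms(3) by (simp add: fundamental_cycle_def)
  then have "\<not> spans G T e"
    by (rule spanning_tree_not_spans) (use assms in auto)
  then show False
    using assms(1,2) spans_if_spanning_tree_avoids[of T "insert e T" e] by auto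
qed

text \<open>The forest \<open>T - {e}\<close> extends to a spanning tree inside the connected set
  \<open>S - {e}\<close>. Spanning trees have equal size, so exactly one edge \<open>f\<close> is
  added.\<close>

lemma fundamental_cocycle_meets:
  assumes T: "spanning_tree G T" and e: "e \<in> T" and S: "T \<subseteq> S" "S \<subseteq> edges G" and "spans G (S - {e}) e"
  obtains f where "f \<in> fundamental_cocycle G T e" "f \<in> S" "f \<noteq> e"
proof -
  have "nc G S = 1"
    using T S linked_mono[of T S G] nc_1_mono unfolding spanning_tree_iff by blast
  then have "nc G (S - {e}) = 1"
    using assms(5) S(2) by (rule nc_1_remove)
  moreover have "forest G (T - {e})"
    using T unfolding spanning_tree_iff by (auto intro: forest_subset)
  ultimately obtain T' where T': "spanning_tree G T'" "T - {e} \<subseteq> T'" "T' \<subseteq> S - {e}"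
    using spanning_tree_extension[of "T - {e}" "S - {e}"] S by blast
  have fin: "finite T" "finite T'"
    using T T' unfolding spanning_tree_iff by (auto intro: finite_subset_edges)
  have "card T' = card T"
    using T T' unfolding spanning_tree_iff_card by simp
  then have "card (T' - (T - {e})) = 1"
    using T'(2) e fin card_Suc_Diff1[of T e] by (simp add: card_Diff_subset)
  then obtain f where "T' - (T - {e}) = {f}"
    by (rule card_1_singletonE)
  then have "T' = T - {e} \<union> {f}" "f \<in> S" "f \<noteq> e"
    using T' by auto
  with T'(1) S that show thesis
    unfolding fundamental_cocycle_def by blast
qed

text \<open>Dually, the forest \<open>insert e A\<close> extends to a spanning tree inside
  \<open>insert e T\<close>, and by size that tree omits exactly one edge \<open>f\<close>.\<close>

lemma fundamental_cycle_meets: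
  assumes T: "spanning_tree G T" and e: "e \<in> edges G - T" and A: "A \<subseteq> T" and "\<not> spans G A e"
  obtains f where "f \<in> fundamental_cycle G T e" "f \<notin> A" "f \<noteq> e"
proof -
  let ?S = "insert e T"
  have "nc G ?S = 1"
    using T linked_mono[of T ?S G] nc_1_mono unfolding spanning_tree_iff by blast
  moreover have "forest G (insert e A)"
    using T A assms(4) e unfolding spanning_tree_iff by (auto intro: forest_insert forest_subset)
  ultimately obtain T' where T': "spanning_tree G T'" "insert e A \<subseteq> T'" "T' \<subseteq> ?S"
    using spanning_tree_extension[of "insert e A" ?S] A e T unfolding spanning_tree_iff by blast
  have fin: "finite T" "finite T'"
    using T T' unfolding spanning_tree_iff by (auto intro: finite_subset_edges)
  have "card T' = card T"
    using T T' unfolding spanning_tree_iff_card by simp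
  then have "card (?S - T') = 1"
    using T'(3) e fin by (simp add: card_Diff_subset)
  then obtain f where "?S - T' = {f}"
    by (rule card_1_singletonE)
  then have "T' = T \<union> {e} - {f}" "f \<in> ?S" "f \<noteq> e" "f \<notin> A"
    using T' by auto
  with T'(1) T e that show thesis
    unfolding fundamental_cycle_def spanning_tree_iff[of T] by blast
qed

section \<open>Summands of the Tutte polynomial of a connected graph\<close>

definition tutte_term :: "'a::comm_ring_1 \<Rightarrow> 'a \<Rightarrow> 'e set \<Rightarrow> 'a" where
  "tutte_term x y S = (x - 1) ^ (nc G S - 1) * (y - 1) ^ (nc G S + card S - card (verts G))"

text \<open>The insertion lowers \<open>nc\<close> and raises the size by one each, so only the
  first exponent changes. Since \<open>nc\<close> stays at least 1, the subtraction there is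
  exact.\<close>

lemma tutte_term_insert_bridge:
  assumes "\<not> spans G S e" "insert e S \<subseteq> edges G" "verts G \<noteq> {}"
  shows "tutte_term x y S = (x - 1) * tutte_term x y (insert e S)"
proof -
  have "e \<notin> S"
    using assms spans_self by blast
  then have "card (insert e S) = Suc (card S)" "nc G S = Suc (nc G (insert e S))"
    using finite_subset_edges[of S] assms nc_insert_not_spans[of S e] by auto
  moreover have "nc G (insert e S) \<ge> 1"
    using nc_pos assms(3) .
  ultimately show ?thesis
    unfolding tutte_term_def by (simp add: power_eq_if mult.assoc)
qed

lemma tutte_term_insert_loop:
  assumes "spans G S e" "e \<notin> S" "insert e S \<subseteq> edges G"
  shows "tutte_term x y (insert e S) = (y - 1) * tutte_term x y S"
proof -
  have "card (insert e S) = Suc (card S)" "nc G (insert e S) = nc G S"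
    using finite_subset_edges[of S] assms nc_insert_spans[of S e] by auto
  moreover have "card (verts G) \<le> nc G S + card S"
    using nc_card_ge assms by blast
  ultimately show ?thesis
    unfolding tutte_term_def by (simp add: Suc_diff_le mult.left_commute)
qed

end

text \<open>
  The rank \<open>r T\<close> orders the edges depending on the tree, but the set of edges ranked below \<open>e\<close>
  only depends on which of these edges belong to \<open>T\<close>. Hence \<open>r\<close> describes a decision tree that
  processes the edges one after the other.
\<close>

locale tree_order = multigraph G for G :: "('v, 'e) mgraph" +
  fixes r :: "'e set \<Rightarrow> 'e \<Rightarrow> nat"
  assumes inj_rank: "spanning_tree G T \<Longrightarrow> inj_on (r T) (edges G)"
    and prefix: "spanning_tree G T \<Longrightarrow> spanning_tree G T' \<Longrightarrow> e \<in> edges G \<Longrightarrow>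
      (\<And>f. f \<in> edges G \<Longrightarrow> r T f < r T e \<Longrightarrow> f \<in> T \<longleftrightarrow> f \<in> T') \<Longrightarrow>
      {f \<in> edges G. r T' f < r T' e} = {f \<in> edges G. r T f < r T e}"
begin

text \<open>All trees between \<open>A\<close> and \<open>edges G - B\<close> have decided the edges
  of \<open>A \<union> B\<close> alike and rank them first. So \<open>prefix\<close> carries the
  lowest undecided edge of one such tree over to all others.\<close>

lemma next_edge:
  assumes "forest G A" "nc G (edges G - B) = 1" "A \<inter> B = {}" "A \<union> B \<subset> edges G"
    and initial: "\<And>T f g. spanning_tree G T \<Longrightarrow> A \<subseteq> T \<Longrightarrow> T \<subseteq> edges G - B \<Longrightarrow> f \<in> A \<union> B \<Longrightarrow>
      g \<in> edges G - (A \<union> B) \<Longrightarrow> r T f < r T g"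
  obtains e where "e \<in> edges G" "e \<notin> A" "e \<notin> B"
    and "\<And>T g. spanning_tree G T \<Longrightarrow> A \<subseteq> T \<Longrightarrow> T \<subseteq> edges G - B \<Longrightarrow>
      g \<in> edges G - (A \<union> B) \<Longrightarrow> g \<noteq> e \<Longrightarrow> r T e < r T g"
proof -
  obtain T where T: "spanning_tree G T" "A \<subseteq> T" "T \<subseteq> edges G - B"
    using spanning_tree_extension[of A "edges G - B"] assms(1-4) by blast
  obtain e where e: "e \<in> edges G - (A \<union> B)" "\<And>g. g \<in> edges G - (A \<union> B) \<Longrightarrow> r T e \<le> r T g"
    using arg_min_if_finite[of "edges G - (A \<union> B)" "r T"] finite_edges assms(4)
    by (metis (no_types, lifting) Diff_eq_empty_iff finite_Diff leI psubset_eq subset_antisym)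
  have eq: "{f \<in> edges G. r T f < r T e} = A \<union> B"
    using e initial[OF T] assms(4) by (fastforce simp: not_less[symmetric])
  have "r T' e < r T' g"
    if T': "spanning_tree G T'" "A \<subseteq> T'" "T' \<subseteq> edges G - B" and g: "g \<in> edges G - (A \<union> B)" "g \<noteq> e" for T' g
  proof -
    have "f \<in> T \<longleftrightarrow> f \<in> T'" if "f \<in> edges G" "r T f < r T e" for f
      using that eq T T' by blast
    then have "{f \<in> edges G. r T' f < r T' e} = A \<union> B"
      using prefix[OF T(1) T'(1)] e(1) eq by blast
    then have "\<not> r T' g < r T' e"
      using g by blast
    moreover have "r T' g \<noteq> r T' e"
      using inj_rank[OF T'(1)] g e(1) by (auto dest: inj_onD)
    ultimately show ?thesis
      by simp
  qed
  with e(1) that show thesis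
    by blast
qed

text \<open>The edge \<open>e\<close> is the first one that \<open>A\<close> and \<open>B\<close>
  leave undecided. If it is no bridge of \<open>edges G - B\<close>, its cocycle has another edge
  outside \<open>B\<close>; that edge is external, hence outside \<open>A\<close>, and ranks later.
  Conversely, a later edge of the cocycle avoids \<open>B\<close> and can replace
  \<open>e\<close>.\<close>

lemma internally_active_iff:
  assumes "spanning_tree G T" "A \<subseteq> T" "T \<subseteq> edges G - B" "e \<in> T" "e \<notin> A"
    and below: "\<And>f. f \<in> A \<union> B \<Longrightarrow> r T f < r T e"
    and above: "\<And>f. f \<in> edges G - (A \<union> B) \<Longrightarrow> f \<noteq> e \<Longrightarrow> r T e < r T f"
  shows "e \<in> internally_active G r T \<longleftrightarrow> \<not> spans G (edges G - B - {e}) e"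
proof
  assume act: "e \<in> internally_active G r T"
  show "\<not> spans G (edges G - B - {e}) e"
  proof
    assume "spans G (edges G - B - {e}) e"
    then obtain f where f: "f \<in> fundamental_cocycle G T e" "f \<in> edges G - B" "f \<noteq> e"
      using fundamental_cocycle_meets[of T e "edges G - B"] assms(1,3,4) by blast
    then have "f \<notin> T"
      using fundamental_cocycle_external assms(1,4) by blast
    then have "r T e < r T f"
      using above f assms(2) by blast
    then show False
      using act f unfolding internally_active_def by fastforce
  qed
next
  assume bridge: "\<not> spans G (edges G - B - {e}) e"
  have "r T f < r T e" if f: "f \<in> fundamental_cocycle G T e" "f \<noteq> e" for f
  proof (rule ccontr)
    assume "\<not> r T f < r T e"
    then have "f \<notin> B"
      using below by blast
    then have "T - {e} \<union> {f} \<subseteq> edges G - B - {e}"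
      using f assms(3) unfolding fundamental_cocycle_def by blast
    then show False
      using bridge spans_if_spanning_tree_avoids[of "T - {e} \<union> {f}" "edges G - B" e] f assms(3,4)
      unfolding fundamental_cocycle_def by blast
  qed
  then show "e \<in> internally_active G r T"
    using assms(4) unfolding internally_active_def by blast
qed

text \<open>The dual argument: if \<open>A\<close> does not span \<open>e\<close>, the cycle has
  another edge outside \<open>A\<close>; that edge is internal, hence outside \<open>B\<close>, and
  ranks later.\<close>

lemma externally_active_iff:
  assumes "spanning_tree G T" "A \<subseteq> T" "T \<subseteq> edges G - B" "e \<in> edges G - T" "e \<notin> B"
    and below: "\<And>f. f \<in> A \<union> B \<Longrightarrow> r T f < r T e"
    and above: "\<And>f. f \<in> edges G - (A \<union> B) \<Longrightarrow> f \<noteq> e \<Longrightarrow> r T e < r T f"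
  shows "e \<in> externally_active G r T \<longleftrightarrow> spans G A e"
proof
  assume act: "e \<in> externally_active G r T"
  show "spans G A e"
  proof (rule ccontr)
    assume "\<not> spans G A e"
    then obtain f where f: "f \<in> fundamental_cycle G T e" "f \<notin> A" "f \<noteq> e"
      using fundamental_cycle_meets[of T e A] assms(1,2,4) by blast
    then have "f \<in> T"
      using fundamental_cycle_internal assms(1,4) by blast
    then have "r T e < r T f"
      using above f assms(3) by blast
    then show False
      using act f unfolding externally_active_def by fastforce
  qed
next
  assume loop: "spans G A e"
  have "r T f < r T e" if f: "f \<in> fundamental_cycle G T e" "f \<noteq> e" for f
  proof (rule ccontr)
    assume "\<not> r T f < r T e"
    then have "f \<notin> A"
      using below by blast
    then show False
      using loop spanning_tree_not_spans[of "T \<union> {e} - {f}" A e] f assms(2,4)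
      unfolding fundamental_cycle_def by blast
  qed
  then show "e \<in> externally_active G r T"
    using assms(4) unfolding externally_active_def by blast
qed

text \<open>Induction on the number of undecided edges. Activities are counted outside
  \<open>A\<close> and \<open>B\<close> only, so each edge contributes its factor at the step that
  decides it.\<close>

lemma sum_interval_eq:
  fixes x y :: "'a::comm_ring_1"
  assumes "forest G A" "nc G (edges G - B) = 1" "A \<inter> B = {}" "A \<union> B \<subseteq> edges G"
    and "\<And>T f g. spanning_tree G T \<Longrightarrow> A \<subseteq> T \<Longrightarrow> T \<subseteq> edges G - B \<Longrightarrow> f \<in> A \<union> B \<Longrightarrow>
      g \<in> edges G - (A \<union> B) \<Longrightarrow> r T f < r T g"
  shows "(\<Sum>S | A \<subseteq> S \<and> S \<subseteq> edges G - B. tutte_term x y S) =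
    (\<Sum>T | A \<subseteq> T \<and> T \<subseteq> edges G - B \<and> spanning_tree G T.
      x ^ card (internally_active G r T - A) * y ^ card (externally_active G r T - B))"
  using assms
proof (induction "card (edges G - (A \<union> B))" arbitrary: A B rule: less_induct)
  case less
  show ?case
  proof (cases "A \<union> B = edges G")
    case True
    then have A: "edges G - B = A"
      using less.prems(3) by blast
    have tree: "spanning_tree G A"
      using less.prems(1,2,4) unfolding spanning_tree_iff A by blast
    have "{S. A \<subseteq> S \<and> S \<subseteq> edges G - B} = {A}" "{T. A \<subseteq> T \<and> T \<subseteq> edges G - B \<and> spanning_tree G T} = {A}"
      using tree unfolding A by auto
    moreover have "internally_active G r A - A = {}" "externally_active G r A - B = {}"
      using A unfolding internally_active_def externally_active_def by auto
    then have "card (internally_active G r A - A) = 0" "card (externally_active G r A - B) = 0"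
      by (simp_all only: card.empty)
    moreover have "tutte_term x y A = 1"
      using tree forest_iff_card[of A] unfolding tutte_term_def spanning_tree_iff by simp
    ultimately show ?thesis
      by simp
  next
    case False
    then obtain e where e: "e \<in> edges G" "e \<notin> A" "e \<notin> B"
      and min: "\<And>T g. spanning_tree G T \<Longrightarrow> A \<subseteq> T \<Longrightarrow> T \<subseteq> edges G - B \<Longrightarrow>
        g \<in> edges G - (A \<union> B) \<Longrightarrow> g \<noteq> e \<Longrightarrow> r T e < r T g"
      using next_edge[of A B] less.prems by blast
    define u where "u = (\<lambda>A B T. x ^ card (internally_active G r T - A) * y ^ card (externally_active G r T - B))"
    have fin: "finite (internally_active G r T)" "finite (externally_active G r T)" if "spanning_tree G T" for T
      using that finite_edges finite_subset_edges[of T]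
      unfolding spanning_tree_iff internally_active_def externally_active_def by auto
    have A_le: "A \<subseteq> edges G" and B_le: "B \<subseteq> edges G"
      using less.prems(4) by auto
    note split = sum_interval_insert[OF finite_edges e A_le B_le]
    have split': "(\<Sum>S | A \<subseteq> S \<and> S \<subseteq> edges G - B. tutte_term x y S) =
      (\<Sum>S | insert e A \<subseteq> S \<and> S \<subseteq> edges G - B. tutte_term x y S) +
      (\<Sum>S | A \<subseteq> S \<and> S \<subseteq> edges G - insert e B. tutte_term x y S)"
      using split[where P = "\<lambda>_. True" and w = "tutte_term x y"] by simp
    have smaller: "card (edges G - (insert e A \<union> B)) < card (edges G - (A \<union> B))"
      "card (edges G - (A \<union> insert e B)) < card (edges G - (A \<union> B))"
      by (rule psubset_card_mono; use e finite_edges in blast)+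
    have below: "r T f < r T e" if "spanning_tree G T" "A \<subseteq> T" "T \<subseteq> edges G - B" "f \<in> A \<union> B" for T f
      using less.prems(5) that e by blast
    \<comment> \<open>Contracting \<open>e\<close> keeps \<open>A\<close> a forest only if
      \<open>e\<close> is no loop, and deleting it (\<open>IH_B\<close>) keeps the graph connected
      only if \<open>e\<close> is no bridge.\<close>
    have IH_A: "(\<Sum>S | insert e A \<subseteq> S \<and> S \<subseteq> edges G - B. tutte_term x y S) =
        (\<Sum>T | insert e A \<subseteq> T \<and> T \<subseteq> edges G - B \<and> spanning_tree G T. u (insert e A) B T)"
      if "\<not> spans G A e"
      unfolding u_def
    proof (rule less.hyps[OF smaller(1)])
      show "forest G (insert e A)"
        using less.prems(1,4) e that by (auto intro: forest_insert)
      show "r T f < r T g" if "spanning_tree G T" "insert e A \<subseteq> T" "T \<subseteq> edges G - B"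
        "f \<in> insert e A \<union> B" "g \<in> edges G - (insert e A \<union> B)" for T f g
        using that less.prems(5)[of T f g] min[of T g] by blast
    qed (use e less.prems in auto)
    have IH_B: "(\<Sum>S | A \<subseteq> S \<and> S \<subseteq> edges G - insert e B. tutte_term x y S) =
        (\<Sum>T | A \<subseteq> T \<and> T \<subseteq> edges G - insert e B \<and> spanning_tree G T. u A (insert e B) T)"
      if "spans G (edges G - B - {e}) e"
      unfolding u_def
    proof (rule less.hyps[OF smaller(2)])
      have "nc G (edges G - B - {e}) = 1"
        using less.prems(2) that by (rule nc_1_remove) blast
      then show "nc G (edges G - insert e B) = 1"
        by (subst Diff_insert)
      show "r T f < r T g" if "spanning_tree G T" "A \<subseteq> T" "T \<subseteq> edges G - insert e B"
        "f \<in> A \<union> insert e B" "g \<in> edges G - (A \<union> insert e B)" for T f g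
        using that less.prems(5)[of T f g] min[of T g] by blast
    qed (use e less.prems in auto)
    have act_A: "e \<in> internally_active G r T \<longleftrightarrow> \<not> spans G (edges G - B - {e}) e" "e \<notin> externally_active G r T"
      if T: "insert e A \<subseteq> T \<and> T \<subseteq> edges G - B \<and> spanning_tree G T" for T
    proof -
      from T have "spanning_tree G T" "A \<subseteq> T" "T \<subseteq> edges G - B" "e \<in> T"
        by auto
      then show "e \<in> internally_active G r T \<longleftrightarrow> \<not> spans G (edges G - B - {e}) e"
        using e(2) by (rule internally_active_iff[OF _ _ _ _ _ below min]) (use T in auto)
      show "e \<notin> externally_active G r T"
        using T unfolding externally_active_def by blast
    qed
    have act_B: "e \<in> externally_active G r T \<longleftrightarrow> spans G A e" "e \<notin> internally_active G r T"
      if T: "A \<subseteq> T \<and> T \<subseteq> edges G - insert e B \<and> spanning_tree G T" for T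
    proof -
      from T e(1) have "spanning_tree G T" "A \<subseteq> T" "T \<subseteq> edges G - B" "e \<in> edges G - T"
        by auto
      then show "e \<in> externally_active G r T \<longleftrightarrow> spans G A e"
        using e(3) by (rule externally_active_iff[OF _ _ _ _ _ below min]) (use T in auto)
      show "e \<notin> internally_active G r T"
        using T unfolding internally_active_def by blast
    qed
    have u_A: "u A B T = (if spans G (edges G - B - {e}) e then 1 else x) * u (insert e A) B T"
      if T: "insert e A \<subseteq> T \<and> T \<subseteq> edges G - B \<and> spanning_tree G T" for T
    proof -
      have "card (internally_active G r T - A) = Suc (card (internally_active G r T - insert e A))"
        if "e \<in> internally_active G r T"
        using that e fin T by (metis Diff_insert DiffI card_Suc_Diff1 finite_Diff)
      then show ?thesis
        using act_A[OF T] unfolding u_def by (simp add: mult.assoc)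
    qed
    have u_B: "u A B T = (if spans G A e then y else 1) * u A (insert e B) T"
      if T: "A \<subseteq> T \<and> T \<subseteq> edges G - insert e B \<and> spanning_tree G T" for T
    proof -
      have "card (externally_active G r T - B) = Suc (card (externally_active G r T - insert e B))"
        if "e \<in> externally_active G r T"
        using that e fin T by (metis Diff_insert DiffI card_Suc_Diff1 finite_Diff)
      then show ?thesis
        using act_B[OF T] unfolding u_def by (simp add: mult.left_commute)
    qed
    have sum_A: "(\<Sum>T | insert e A \<subseteq> T \<and> T \<subseteq> edges G - B \<and> spanning_tree G T. u A B T) =
      (if spans G (edges G - B - {e}) e then 1 else x) *
      (\<Sum>T | insert e A \<subseteq> T \<and> T \<subseteq> edges G - B \<and> spanning_tree G T. u (insert e A) B T)"
      unfolding sum_distrib_left by (rule sum.cong) (use u_A in auto)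
    have sum_B: "(\<Sum>T | A \<subseteq> T \<and> T \<subseteq> edges G - insert e B \<and> spanning_tree G T. u A B T) =
      (if spans G A e then y else 1) *
      (\<Sum>T | A \<subseteq> T \<and> T \<subseteq> edges G - insert e B \<and> spanning_tree G T. u A (insert e B) T)"
      unfolding sum_distrib_left by (rule sum.cong) (use u_B in auto)
    have V: "verts G \<noteq> {}"
      using less.prems(2) unfolding nc_eq_1_iff by blast
    \<comment> \<open>For a loop no tree contains \<open>e\<close>, and the contracted sum is
      \<open>y - 1\<close> times the deleted one, which gives the factor
      \<open>1 + (y - 1) = y\<close> in total. A bridge gives \<open>x\<close> in the same way with
      the roles exchanged. Otherwise both induction hypotheses apply and neither factor
      appears.\<close>
    consider (loop) "spans G A e" | (bridge) "\<not> spans G (edges G - B - {e}) e"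
      | (neither) "\<not> spans G A e" "spans G (edges G - B - {e}) e"
      by blast
    then have "(\<Sum>S | A \<subseteq> S \<and> S \<subseteq> edges G - B. tutte_term x y S) =
      (\<Sum>T | A \<subseteq> T \<and> T \<subseteq> edges G - B \<and> spanning_tree G T. u A B T)"
    proof cases
      case loop
      have "(\<Sum>T | insert e A \<subseteq> T \<and> T \<subseteq> edges G - B \<and> spanning_tree G T. u A B T) = 0"
        by (rule sum.neutral) (use loop spanning_tree_not_spans[of _ A e] e in blast)
      moreover have "(\<Sum>S | insert e A \<subseteq> S \<and> S \<subseteq> edges G - B. tutte_term x y S) =
          (y - 1) * (\<Sum>S | A \<subseteq> S \<and> S \<subseteq> edges G - insert e B. tutte_term x y S)"
        unfolding sum_interval_reindex[OF e] sum_distrib_left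
      proof (rule sum.cong)
        fix S assume "S \<in> {S. A \<subseteq> S \<and> S \<subseteq> edges G - insert e B}"
        then show "tutte_term x y (insert e S) = (y - 1) * tutte_term x y S"
          using loop e by (intro tutte_term_insert_loop) (auto intro: spans_mono)
      qed simp
      moreover have "spans G (edges G - B - {e}) e"
        using loop e less.prems(3,4) by (auto intro: spans_mono)
      ultimately show ?thesis
        unfolding split split' using IH_B sum_B loop by (simp add: algebra_simps)
    next
      case bridge
      have "(\<Sum>T | A \<subseteq> T \<and> T \<subseteq> edges G - insert e B \<and> spanning_tree G T. u A B T) = 0"
        by (rule sum.neutral) (use bridge spans_if_spanning_tree_avoids[of _ "edges G - B" e] e in blast)
      moreover have "(\<Sum>S | A \<subseteq> S \<and> S \<subseteq> edges G - insert e B. tutte_term x y S) =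
          (x - 1) * (\<Sum>S | insert e A \<subseteq> S \<and> S \<subseteq> edges G - B. tutte_term x y S)"
        unfolding sum_interval_reindex[OF e] sum_distrib_left
      proof (rule sum.cong)
        fix S assume "S \<in> {S. A \<subseteq> S \<and> S \<subseteq> edges G - insert e B}"
        then show "tutte_term x y S = (x - 1) * tutte_term x y (insert e S)"
          using bridge e V spans_mono[of G S e "edges G - B - {e}"] by (intro tutte_term_insert_bridge) auto
      qed simp
      moreover have "\<not> spans G A e"
        using bridge e less.prems(3,4) spans_mono[of G A e "edges G - B - {e}"] by blast
      ultimately show ?thesis
        unfolding split split' using IH_A sum_A bridge by (simp add: algebra_simps)
    next
      case neither
      then show ?thesis
        unfolding split split' using IH_A IH_B sum_A sum_B by simp
    qed
    then show ?thesis
      unfolding u_def .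
  qed
qed

theorem tutte_eq_sum_activities:
  fixes x y :: "'a::comm_ring_1"
  assumes "nc G (edges G) = 1"
  shows "tutte G x y = (\<Sum>T | spanning_tree G T.
    x ^ card (internally_active G r T) * y ^ card (externally_active G r T))"
proof -
  have "num_components G = nc G (edges G)"
    unfolding nc_def spanning_subgraph_def by simp
  then have "tutte G x y = (\<Sum>S | {} \<subseteq> S \<and> S \<subseteq> edges G - {}. tutte_term x y S)"
    using assms unfolding tutte_def tutte_term_def nc_def[symmetric] Pow_def by simp
  also have "\<dots> = (\<Sum>T | {} \<subseteq> T \<and> T \<subseteq> edges G - {} \<and> spanning_tree G T.
      x ^ card (internally_active G r T - {}) * y ^ card (externally_active G r T - {}))"
    by (rule sum_interval_eq) (use assms in \<open>auto simp: forest_def\<close>)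
  also have "{T. {} \<subseteq> T \<and> T \<subseteq> edges G - {} \<and> spanning_tree G T} = {T. spanning_tree G T}"
    by (auto simp: spanning_tree_def)
  finally show ?thesis
    by simp
qed

end

section \<open>The tour of a spanning tree\<close>

text \<open>The time of the first visit to \<open>e\<close> on the tour run backwards, where time
  \<open>k\<close> is position \<open>N - k\<close> and time 0 is the root, reached after a full
  turn.\<close>

definition tour_rank :: "('h, 'z) rooted_cmap_scheme \<Rightarrow> 'h set set \<Rightarrow> 'h set \<Rightarrow> nat" where
  "tour_rank M T e = card (half_edges M) - Max (half_edge_pos M T ` e)"

context combinatorial_map
begin

abbreviation UG :: "('h set, 'h set) mgraph" where "UG \<equiv> underlying_graph M"
abbreviation edge_of :: "'h \<Rightarrow> 'h set" where "edge_of \<equiv> orbit (alpha M)"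
abbreviation vertex_of :: "'h \<Rightarrow> 'h set" where "vertex_of \<equiv> orbit (sigma M)"
abbreviation motion_rel :: "'h set set \<Rightarrow> ('h \<times> 'h) set" where
  "motion_rel T \<equiv> {(h, h'). h' = motion M T h}"

section \<open>Edges and vertices as orbits\<close>

lemma alpha_in: "h \<in> half_edges M \<Longrightarrow> alpha M h \<in> half_edges M"
  using alpha_permutes by (simp add: permutes_in_image)

lemma sigma_in: "h \<in> half_edges M \<Longrightarrow> sigma M h \<in> half_edges M"
  using sigma_permutes by (simp add: permutes_in_image)

lemma motion_in: "h \<in> half_edges M \<Longrightarrow> motion M T h \<in> half_edges M"
  by (simp add: motion_def alpha_in sigma_in)

lemma permutation_sigma: "permutation (sigma M)"
  using sigma_permutes finite_half_edges unfolding permutation_permutes by blast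

lemma edge_of_eq: "h \<in> half_edges M \<Longrightarrow> edge_of h = {h, alpha M h}"
proof -
  assume "h \<in> half_edges M"
  then have "orbit (alpha M) h = {(alpha M ^^ m) h | m. m < 2}"
    using alpha_involution by (intro orbit_altdef_bounded) (simp_all add: numeral_2_eq_2)
  also have "\<dots> = {h, alpha M h}"
    by (auto simp: numeral_2_eq_2 less_Suc_eq intro: exI[of _ 0] exI[of _ "Suc 0"])
  finally show ?thesis .
qed

lemma edges_UG: "e \<in> edges UG \<longleftrightarrow> (\<exists>h\<in>half_edges M. e = edge_of h)"
  by (auto simp: underlying_graph_def)

lemma edge_of_in: "h \<in> half_edges M \<Longrightarrow> edge_of h \<in> edges UG"
  unfolding edges_UG by blast

lemma in_edge_iff: "e \<in> edges UG \<Longrightarrow> h \<in> e \<longleftrightarrow> h \<in> half_edges M \<and> edge_of h = e"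
  unfolding edges_UG using edge_of_eq alpha_in alpha_involution by (metis doubleton_eq_iff insert_iff singletonD)

lemma vertex_of_sigma: "vertex_of (sigma M h) = vertex_of h"
  by (rule permutation_orbit_step[OF permutation_sigma])

lemma vertex_of_eq_iff: "vertex_of h = vertex_of h' \<longleftrightarrow> h' \<in> vertex_of h"
  by (metis cyclic_on_orbit' orbit_cyclic_eq3 permutation_self_in_orbit permutation_sigma)

lemma ends_UG: "h \<in> half_edges M \<Longrightarrow> ends UG (edge_of h) = {vertex_of h, vertex_of (alpha M h)}"
  unfolding underlying_graph_def
  by (auto simp: edge_of_eq alpha_in vertex_of_eq_iff permutation_self_in_orbit[OF permutation_sigma])
    (metis vertex_of_eq_iff)+

lemma multigraph_UG: "multigraph UG"
proof
  show "finite (verts UG)" "finite (edges UG)"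
    using finite_half_edges by (simp_all add: underlying_graph_def)
  fix e assume "e \<in> edges UG"
  then obtain h where h: "h \<in> half_edges M" "e = edge_of h"
    unfolding edges_UG by blast
  then show "ends UG e \<subseteq> verts UG"
    by (simp add: underlying_graph_def)
  show "card (ends UG e) = 1 \<or> card (ends UG e) = 2"
    using h ends_UG[OF h(1)] by (cases "vertex_of h = vertex_of (alpha M h)") simp_all
qed

end

sublocale combinatorial_map \<subseteq> UG: multigraph "underlying_graph M"
  by (rule multigraph_UG)

context combinatorial_map
begin

section \<open>The motion function and connectivity\<close>

lemma linked_alpha:
  assumes "h \<in> half_edges M" "edge_of h \<in> T"
  shows "(vertex_of h, vertex_of (alpha M h)) \<in> linked UG T"
  by (rule linked_edge[OF assms(2) ends_UG[OF assms(1)]])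

text \<open>Since \<open>sigma\<close> turns around a vertex, a step changes vertex only by crossing
  an internal edge. Only that edge must lie in \<open>T'\<close>, so \<open>T'\<close> may be
  \<open>T\<close> with some other edge removed.\<close>

lemma linked_motion:
  assumes "h \<in> half_edges M" "edge_of h \<in> T \<Longrightarrow> edge_of h \<in> T'"
  shows "(vertex_of h, vertex_of (motion M T h)) \<in> linked UG T'"
proof (cases "edge_of h \<in> T")
  case True
  with assms linked_alpha show ?thesis
    by (simp add: motion_def internal_half_edge_def vertex_of_sigma)
qed (simp add: motion_def internal_half_edge_def vertex_of_sigma)

lemma linked_motion_reachable:
  assumes "(h, h') \<in> (motion_rel T)\<^sup>*" "h \<in> half_edges M"
  shows "h' \<in> half_edges M \<and> (vertex_of h, vertex_of h') \<in> linked UG T"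
  using assms
proof (induction rule: rtrancl_induct)
  case (step h1 h2)
  then show ?case
    using motion_in[of h1 T] linked_motion[of h1 T T] by (auto intro: linked_trans)
qed simp

text \<open>
  Adding to a forest an edge between two of its components merges two cycles of the motion function.
\<close>

lemma motion_reachable_if_linked:
  assumes "forest UG F" "F \<subseteq> edges UG" "h \<in> half_edges M" "h' \<in> half_edges M"
    and "(vertex_of h, vertex_of h') \<in> linked UG F"
  shows "(h, h') \<in> (motion_rel F)\<^sup>*"
  using UG.finite_subset_edges[OF assms(2)] assms
proof (induction F arbitrary: h h' rule: finite_induct)
  case empty
  then have "h' \<in> vertex_of h"
    by (simp add: linked_empty vertex_of_eq_iff)
  then have "(h, h') \<in> {(h, h'). h' = sigma M h}\<^sup>*"
    by induction (auto intro: rtrancl_into_rtrancl)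
  then show ?case
    by (simp add: motion_def internal_half_edge_def)
next
  case (insert e F)
  have F: "forest UG F" "F \<subseteq> edges UG" and e: "\<not> spans UG F e" "e \<in> edges UG"
    using insert.prems(1,2) insert.hyps forest_subset[of UG "insert e F" F] by (auto simp: forest_def)
  note IH = insert.IH[OF F]
  have motion_eq: "motion M (insert e F) h = motion M F h" if "h \<in> half_edges M" "edge_of h \<noteq> e" for h
    using that by (simp add: motion_def internal_half_edge_def)
  \<comment> \<open>At a half-edge \<open>c\<close> of \<open>e\<close> the new motion continues as
    the old one does from the opposite half-edge \<open>d\<close>. It runs through the old cycle of
    \<open>d\<close>, comes back to \<open>d\<close>, and continues as the old motion does from
    \<open>c\<close>.\<close>
  have detour: "(c, d) \<in> (motion_rel (insert e F))\<^sup>*" "(c, motion M F c) \<in> (motion_rel (insert e F))\<^sup>*"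
    if c: "c \<in> half_edges M" "edge_of c = e" and d: "d = alpha M c" for c d
  proof -
    have d': "d \<in> half_edges M" "edge_of d = e" "alpha M d = c" "e = {c, d}"
      using c d alpha_in alpha_involution edge_of_eq by (auto simp: insert_commute)
    have not: "(vertex_of c, vertex_of d) \<notin> linked UG F"
      using e(1) ends_UG[OF c(1)] unfolding c(2) d[symmetric] by (simp add: spans_iff)
    have "e \<notin> F"
      using insert.hyps by simp
    then have cd: "motion M (insert e F) c = motion M F d" "motion M (insert e F) d = motion M F c"
      using c d d' by (simp_all add: motion_def internal_half_edge_def)
    \<comment> \<open>The old path to \<open>d\<close> stays in the component of \<open>d\<close>,
      so it never meets \<open>c\<close>; before reaching \<open>d\<close>, its steps are therefore
      also steps of the new motion.\<close>
    have to_d: "(z, d) \<in> (motion_rel (insert e F))\<^sup>*"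
      if z: "z \<in> half_edges M" "(vertex_of z, vertex_of d) \<in> linked UG F" for z
    proof -
      have "(z, d) \<in> (motion_rel F)\<^sup>*"
        using IH z d' by blast
      then show ?thesis
        using z(1)
      proof (induction rule: converse_rtrancl_induct)
        case (step y y')
        show ?case
        proof (cases "y = d")
          case False
          have "(y, d) \<in> (motion_rel F)\<^sup>*"
            using step.hyps by (rule converse_rtrancl_into_rtrancl)
          then have "y \<noteq> c"
            using not linked_motion_reachable[of y d F] step.prems by blast
          with False have "edge_of y \<noteq> e"
            using step.prems e(2) d'(4) in_edge_iff by blast
          then have "y' = motion M (insert e F) y"
            using motion_eq step by auto
          moreover have "y' \<in> half_edges M"
            using step motion_in by auto
          ultimately show ?thesis
            using step.IH by (intro converse_rtrancl_into_rtrancl[of y y']) auto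
        qed simp
      qed simp
    qed
    have "motion M F d \<in> half_edges M" "(vertex_of (motion M F d), vertex_of d) \<in> linked UG F"
      using d'(1) motion_in linked_sym[OF linked_motion[of d F F]] by simp_all
    then have "(motion M F d, d) \<in> (motion_rel (insert e F))\<^sup>*"
      by (rule to_d)
    moreover have "(c, motion M F d) \<in> motion_rel (insert e F)" "(d, motion M F c) \<in> motion_rel (insert e F)"
      using cd by simp_all
    ultimately show "(c, d) \<in> (motion_rel (insert e F))\<^sup>*" "(c, motion M F c) \<in> (motion_rel (insert e F))\<^sup>*"
      by (meson converse_rtrancl_into_rtrancl rtrancl_into_rtrancl)+
  qed
  \<comment> \<open>Each old step either survives or starts on \<open>e\<close>, and in the latter
    case the detour replaces it.\<close>
  have within: "(z, z') \<in> (motion_rel (insert e F))\<^sup>*"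
    if z: "z \<in> half_edges M" "z' \<in> half_edges M" "(vertex_of z, vertex_of z') \<in> linked UG F" for z z'
  proof -
    have "(z, z') \<in> (motion_rel F)\<^sup>*"
      using IH z by blast
    then show ?thesis
      using z(1)
    proof (induction rule: converse_rtrancl_induct)
      case (step y y')
      have "y' \<in> half_edges M"
        using step motion_in by auto
      moreover have "(y, y') \<in> (motion_rel (insert e F))\<^sup>*"
      proof (cases "edge_of y = e")
        case True
        then show ?thesis
          using detour(2) step by auto
      next
        case False
        then show ?thesis
          using motion_eq step by (intro r_into_rtrancl) auto
      qed
      ultimately show ?case
        using step.IH by (meson rtrancl_trans)
    qed simp
  qed
  obtain a where a: "a \<in> half_edges M" "e = edge_of a"
    using e(2) unfolding edges_UG by blast
  let ?b = "alpha M a"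
  have b: "?b \<in> half_edges M" "edge_of ?b = e" "alpha M ?b = a"
    using a alpha_in alpha_involution edge_of_eq by (auto simp: insert_commute)
  have ab: "(a, ?b) \<in> (motion_rel (insert e F))\<^sup>*" "(?b, a) \<in> (motion_rel (insert e F))\<^sup>*"
    using detour(1)[of a ?b] detour(1)[of ?b a] a b by auto
  have "ends UG e = {vertex_of a, vertex_of ?b}"
    using a ends_UG by blast
  from insert.prems(5)[unfolded linked_insert[OF this]]
  consider "(vertex_of h, vertex_of h') \<in> linked UG F"
    | "(vertex_of h, vertex_of a) \<in> linked UG F" "(vertex_of ?b, vertex_of h') \<in> linked UG F"
    | "(vertex_of h, vertex_of ?b) \<in> linked UG F" "(vertex_of a, vertex_of h') \<in> linked UG F"
    by blast
  then show ?case
    using within ab a(1) b(1) insert.prems(3,4) by cases (meson rtrancl_trans)+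
qed

end

context rooted_combinatorial_map
begin

section \<open>The tour as a cyclic enumeration of the half-edges\<close>

abbreviation tour :: "'h set set \<Rightarrow> nat \<Rightarrow> 'h" where
  "tour T i \<equiv> (motion M T ^^ i) (root M)"
abbreviation pos :: "'h set set \<Rightarrow> 'h \<Rightarrow> nat" where
  "pos \<equiv> half_edge_pos M"
abbreviation N :: nat where
  "N \<equiv> card (half_edges M)"

lemma orbit_motion:
  assumes "spanning_tree UG T"
  shows "orbit (motion M T) (root M) = half_edges M"
proof
  show "orbit (motion M T) (root M) \<subseteq> half_edges M"
  proof
    fix h assume "h \<in> orbit (motion M T) (root M)"
    then show "h \<in> half_edges M"
      by induction (auto intro: motion_in root_in)
  qed
  show "half_edges M \<subseteq> orbit (motion M T) (root M)"
  proof
    fix h assume h: "h \<in> half_edges M"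
    \<comment> \<open>An \<open>orbit\<close> consists of the points reached after at least one
      step, so the path starts at the successor of the root.\<close>
    let ?r = "motion M T (root M)"
    have "vertex_of ?r \<in> verts UG" "vertex_of h \<in> verts UG"
      using h root_in motion_in by (auto simp: underlying_graph_def)
    then have "(vertex_of ?r, vertex_of h) \<in> linked UG T"
      using assms UG.nc_eq_1_iff unfolding UG.spanning_tree_iff by blast
    then have "(?r, h) \<in> (motion_rel T)\<^sup>*"
      using assms h root_in motion_in motion_reachable_if_linked unfolding UG.spanning_tree_iff by blast
    then show "h \<in> orbit (motion M T) (root M)"
      by (induction rule: rtrancl_induct) (auto intro: orbit.intros)
  qed
qed

lemma tour_cyclic:
  assumes "spanning_tree UG T"
  shows tour_N: "tour T N = root M"
    and inj_on_tour: "inj_on (tour T) {0..<N}"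
    and range_tour: "tour T ` {0..<N} = half_edges M"
proof -
  let ?f = "motion M T" and ?x = "root M"
  have x: "?x \<in> orbit ?f ?x"
    using orbit_motion[OF assms] root_in by simp
  have inj: "inj_on (tour T) {0..<funpow_dist1 ?f ?x ?x}"
    using inj_on_funpow_dist1[OF x] .
  moreover have im: "tour T ` {0..<funpow_dist1 ?f ?x ?x} = half_edges M"
    using orbit_conv_funpow_dist1[OF x] orbit_motion[OF assms] by simp
  ultimately have "N = funpow_dist1 ?f ?x ?x"
    by (metis card_atLeastLessThan card_image minus_nat.diff_0)
  with inj im funpow_dist1_prop[OF x]
  show "tour T N = root M" "inj_on (tour T) {0..<N}" "tour T ` {0..<N} = half_edges M"
    by simp_all
qed

lemma tour_in: "tour T i \<in> half_edges M"
  by (induction i) (auto intro: root_in motion_in)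

lemma pos_tour:
  assumes "spanning_tree UG T" "i < N"
  shows "pos T (tour T i) = i"
  unfolding half_edge_pos_def
proof (rule Least_equality)
  show "i \<le> j" if "tour T j = tour T i" for j
  proof (rule ccontr)
    assume "\<not> i \<le> j"
    then show False
      using that assms(2) inj_on_tour[OF assms(1)] by (auto dest: inj_onD)
  qed
qed simp

lemma
  assumes "spanning_tree UG T" "h \<in> half_edges M"
  shows pos_less: "pos T h < N" and tour_pos: "tour T (pos T h) = h"
proof -
  have "h \<in> tour T ` {0..<N}"
    using assms range_tour by blast
  then obtain i where i: "i < N" "h = tour T i"
    by auto
  then have "pos T h = i"
    using pos_tour[OF assms(1)] by blast
  with i show "pos T h < N" "tour T (pos T h) = h"
    by simp_all
qed

section \<open>Backward visits\<close>

lemma finite_edge: "e \<in> edges UG \<Longrightarrow> finite e"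
  and edge_nonempty: "e \<in> edges UG \<Longrightarrow> e \<noteq> {}"
  unfolding edges_UG using edge_of_eq by auto

text \<open>Any visit at backward time \<open>k\<close> bounds the time of the first one. With
  \<open>1 \<le> k\<close> the position is below \<open>N\<close>, where \<open>pos_tour\<close>
  applies.\<close>

lemma tour_rank_le:
  assumes "spanning_tree UG T" "e \<in> edges UG" "tour T (N - k) \<in> e" "1 \<le> k" "k \<le> N"
  shows "tour_rank M T e \<le> k"
proof -
  have "pos T (tour T (N - k)) = N - k"
    using assms by (intro pos_tour) auto
  then have "N - k \<in> pos T ` e"
    using assms(3) by (metis imageI)
  then have "N - k \<le> Max (pos T ` e)"
    using finite_edge[OF assms(2)] by simp
  then show ?thesis
    unfolding tour_rank_def using assms(5) by linarith
qed

lemma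
  assumes "spanning_tree UG T" "e \<in> edges UG"
  shows tour_rank_pos: "1 \<le> tour_rank M T e" and tour_rank_le_N: "tour_rank M T e \<le> N"
    and tour_rank_in: "tour T (N - tour_rank M T e) \<in> e"
    and Max_pos_less: "Max (pos T ` e) < N"
proof -
  have "Max (pos T ` e) \<in> pos T ` e"
    using finite_edge edge_nonempty assms(2) by simp
  then obtain h where h: "h \<in> e" "Max (pos T ` e) = pos T h"
    by blast
  then have "h \<in> half_edges M"
    using assms(2) in_edge_iff by blast
  note h_pos = pos_less[OF assms(1) this] tour_pos[OF assms(1) this]
  then have "N - (N - pos T h) = pos T h"
    by simp
  with h h_pos show "1 \<le> tour_rank M T e" "tour_rank M T e \<le> N" "tour T (N - tour_rank M T e) \<in> e"
    "Max (pos T ` e) < N"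
    unfolding tour_rank_def by (simp_all add: Suc_le_eq)
qed

text \<open>This is why the tour is followed backwards: the edge of the predecessor of a half-edge
  does not depend on the tree, and whether that edge is internal determines the predecessor
  itself.\<close>

lemma motion_eq_motionD:
  assumes "motion M T h = motion M T' h'" "h \<in> half_edges M" "h' \<in> half_edges M"
  shows "edge_of h = edge_of h'" and "edge_of h \<in> T \<longleftrightarrow> edge_of h \<in> T' \<Longrightarrow> h = h'"
proof -
  have inj: "\<And>a b. sigma M a = sigma M b \<Longrightarrow> a = b" "\<And>a b. alpha M a = alpha M b \<Longrightarrow> a = b"
    using sigma_permutes alpha_permutes by (auto dest: permutes_inj injD)
  have "h = h' \<or> h = alpha M h' \<or> alpha M h = h' \<or> alpha M h = alpha M h'"
    using assms(1) by (auto simp: motion_def split: if_splits dest: inj)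
  then show *: "edge_of h = edge_of h'"
    using assms(2,3) edge_of_eq alpha_involution inj(2) by (metis insert_commute)
  show "edge_of h \<in> T \<longleftrightarrow> edge_of h \<in> T' \<Longrightarrow> h = h'"
    using assms(1) unfolding motion_def internal_half_edge_def * by (auto split: if_splits dest: inj)
qed

text \<open>By induction on backward time, using \<open>motion_eq_motionD\<close>. At time
  \<open>R\<close> only the edges need agree, since the trees may differ on an edge of rank
  \<open>R\<close>.\<close>

lemma tours_agree:
  assumes T: "spanning_tree UG T" and T': "spanning_tree UG T'" and "R \<le> N"
    and agree: "\<And>f. f \<in> edges UG \<Longrightarrow> tour_rank M T f < R \<Longrightarrow> f \<in> T \<longleftrightarrow> f \<in> T'"
    and "k \<le> R"
  shows "(k < R \<longrightarrow> tour T (N - k) = tour T' (N - k)) \<and>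
    (1 \<le> k \<longrightarrow> edge_of (tour T (N - k)) = edge_of (tour T' (N - k)))"
  using \<open>k \<le> R\<close>
proof (induction k)
  case 0
  then show ?case
    using tour_N T T' by simp
next
  case (Suc k)
  let ?i = "N - Suc k"
  have i: "N - k = Suc ?i"
    using Suc.prems assms(3) by simp
  have "motion M T (tour T ?i) = motion M T' (tour T' ?i)"
    using Suc.IH Suc.prems unfolding i by simp
  note eq = motion_eq_motionD[OF this tour_in tour_in]
  have "tour T ?i = tour T' ?i" if "Suc k < R"
  proof (rule eq(2))
    \<comment> \<open>The edge just met has rank at most \<open>Suc k\<close>, which is below
      \<open>R\<close>, so both trees treat it alike.\<close>
    have "tour_rank M T (edge_of (tour T ?i)) \<le> Suc k"
      using T edge_of_in tour_in in_edge_iff Suc.prems assms(3) by (intro tour_rank_le) auto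
    then show "edge_of (tour T ?i) \<in> T \<longleftrightarrow> edge_of (tour T ?i) \<in> T'"
      using agree edge_of_in tour_in that by simp
  qed
  with eq(1) show ?case
    by simp
qed

text \<open>Ranks are read off from the backward tours, and these agree up to time \<open>R\<close>,
  the rank of \<open>e\<close>.\<close>

lemma tree_order: "tree_order UG (tour_rank M)"
proof
  fix T assume T: "spanning_tree UG T"
  show "inj_on (tour_rank M T) (edges UG)"
  proof (rule inj_onI)
    fix e f assume "e \<in> edges UG" "f \<in> edges UG" "tour_rank M T e = tour_rank M T f"
    then show "e = f"
      using tour_rank_in[OF T] in_edge_iff by metis
  qed
  fix T' e
  assume T': "spanning_tree UG T'" and e: "e \<in> edges UG"
    and agree: "\<And>f. f \<in> edges UG \<Longrightarrow> tour_rank M T f < tour_rank M T e \<Longrightarrow> f \<in> T \<longleftrightarrow> f \<in> T'"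
  define R where "R = tour_rank M T e"
  have R: "1 \<le> R" "R \<le> N"
    unfolding R_def using tour_rank_pos tour_rank_le_N T e by auto
  note eq = tours_agree[OF T T' R(2) agree, folded R_def]
  have iff: "tour_rank M T' f < R \<longleftrightarrow> tour_rank M T f < R" if f: "f \<in> edges UG" for f
  proof
    assume less: "tour_rank M T' f < R"
    then have "tour T (N - tour_rank M T' f) \<in> f"
      using eq[of "tour_rank M T' f"] tour_rank_in[OF T' f] by simp
    then have "tour_rank M T f \<le> tour_rank M T' f"
      using tour_rank_pos[OF T' f] tour_rank_le_N[OF T' f] by (rule tour_rank_le[OF T f])
    with less show "tour_rank M T f < R"
      by simp
  next
    assume less: "tour_rank M T f < R"
    then have "tour T' (N - tour_rank M T f) \<in> f"
      using eq[of "tour_rank M T f"] tour_rank_in[OF T f] by simp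
    then have "tour_rank M T' f \<le> tour_rank M T f"
      using tour_rank_pos[OF T f] tour_rank_le_N[OF T f] by (rule tour_rank_le[OF T' f])
    with less show "tour_rank M T' f < R"
      by simp
  qed
  \<comment> \<open>At time \<open>R\<close> both tours are on \<open>e\<close>, possibly at
    different half-edges, because \<open>T\<close> and \<open>T'\<close> may disagree on
    \<open>e\<close>.\<close>
  have "edge_of (tour T' (N - R)) = e"
    using eq[of R] R tour_rank_in[OF T e] in_edge_iff[OF e] unfolding R_def by auto
  then have "tour T' (N - R) \<in> e"
    using in_edge_iff[OF e] tour_in by blast
  then have "tour_rank M T' e \<le> R"
    using R by (rule tour_rank_le[OF T' e])
  moreover have "\<not> tour_rank M T' e < R"
    using iff[OF e] R_def by simp
  ultimately have "tour_rank M T' e = R"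
    by simp
  then show "{f \<in> edges UG. tour_rank M T' f < tour_rank M T' e} =
      {f \<in> edges UG. tour_rank M T f < tour_rank M T e}"
    using iff unfolding R_def[symmetric] by auto
qed

text \<open>Only a step leaving from a half-edge of \<open>f\<close> can cross \<open>f\<close>, so
  the final position \<open>j\<close> may itself lie on \<open>f\<close>.\<close>

lemma linked_tour:
  assumes "f \<in> edges UG" "i \<le> j" "\<And>k. i \<le> k \<Longrightarrow> k < j \<Longrightarrow> tour T k \<notin> f"
  shows "(vertex_of (tour T i), vertex_of (tour T j)) \<in> linked UG (T - {f})"
  using assms(2,3)
proof (induction j rule: dec_induct)
  case (step j)
  have "edge_of (tour T j) \<noteq> f"
    using step.prems[of j] step.hyps in_edge_iff[OF assms(1)] tour_in by auto
  then have "(vertex_of (tour T j), vertex_of (tour T (Suc j))) \<in> linked UG (T - {f})"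
    using linked_motion[of "tour T j" T "T - {f}"] tour_in by simp
  moreover have "(vertex_of (tour T i), vertex_of (tour T j)) \<in> linked UG (T - {f})"
    using step by simp
  ultimately show ?case
    by (blast intro: linked_trans)
qed simp

lemma edge_positions:
  assumes T: "spanning_tree UG T" and e: "e \<in> edges UG"
  obtains a b where "e = {a, b}" "a \<in> half_edges M" "b \<in> half_edges M" "b = alpha M a" "pos T a < pos T b"
    "Min (pos T ` e) = pos T a" "Max (pos T ` e) = pos T b"
proof -
  obtain c where c: "c \<in> half_edges M" "e = {c, alpha M c}"
    using e edge_of_eq unfolding edges_UG by blast
  have "pos T c \<noteq> pos T (alpha M c)"
    using c alpha_in alpha_no_fixpoint tour_pos[OF T] by metis
  then consider "pos T c < pos T (alpha M c)" | "pos T (alpha M c) < pos T c"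
    by linarith
  then show thesis
  proof cases
    case 1
    then show thesis
      using c alpha_in by (intro that[of c "alpha M c"]) auto
  next
    case 2
    then show thesis
      using c alpha_in alpha_involution by (intro that[of "alpha M c" c]) auto
  qed
qed

text \<open>
  Removing \<open>f\<close> from \<open>T\<close> cuts the tour at the two occurrences of \<open>f\<close>, and the two pieces visit
  different components. Hence the two half-edges of \<open>e\<close> are separated on the tour by those of \<open>f\<close>.
\<close>

lemma crossing:
  assumes T: "spanning_tree UG T" and f: "f \<in> T" and e: "e \<in> edges UG - T"
    and exchange: "spanning_tree UG (T - {f} \<union> {e})"
  shows "Min (pos T ` e) < Min (pos T ` f) \<longleftrightarrow> Max (pos T ` e) < Max (pos T ` f)"
    and "Min (pos T ` e) \<noteq> Min (pos T ` f)" and "Max (pos T ` e) \<noteq> Max (pos T ` f)"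
proof -
  have f_edge: "f \<in> edges UG" and e_edge: "e \<in> edges UG" and "e \<noteq> f"
    using T f e by (auto simp: spanning_tree_def)
  obtain a b where ab: "e = {a, b}" "a \<in> half_edges M" "b \<in> half_edges M" "b = alpha M a" "pos T a < pos T b"
    "Min (pos T ` e) = pos T a" "Max (pos T ` e) = pos T b"
    using edge_positions[OF T e_edge] .
  obtain c d where cd: "f = {c, d}" "c \<in> half_edges M" "d \<in> half_edges M" "d = alpha M c" "pos T c < pos T d"
    "Min (pos T ` f) = pos T c" "Max (pos T ` f) = pos T d"
    using edge_positions[OF T f_edge] .
  have "h \<noteq> h'" if "h \<in> e" "h' \<in> f" for h h'
    using that in_edge_iff[OF e_edge] in_edge_iff[OF f_edge] \<open>e \<noteq> f\<close> by auto
  then have ne: "pos T h \<noteq> pos T h'" if "h \<in> e" "h' \<in> f" for h h'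
    using that in_edge_iff[OF e_edge] in_edge_iff[OF f_edge] tour_pos[OF T] by metis
  then show "Min (pos T ` e) \<noteq> Min (pos T ` f)" "Max (pos T ` e) \<noteq> Max (pos T ` f)"
    using ab cd by auto
  have on_f: "k = pos T c \<or> k = pos T d" if "tour T k \<in> f" "k < N" for k
    using that pos_tour[OF T, of k] cd(1) by auto
  let ?L = "linked UG (T - {f})"
  \<comment> \<open>The stretch after \<open>c\<close> up to \<open>d\<close> inclusive makes no
    step across \<open>f\<close>. The complementary stretch (\<open>outer\<close>) runs after
    \<open>d\<close> through the root up to \<open>c\<close> inclusive.\<close>
  have inner: "(vertex_of (tour T (Suc (pos T c))), vertex_of h) \<in> ?L"
    if h: "h \<in> half_edges M" "pos T c < pos T h" "pos T h \<le> pos T d" for h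
  proof -
    have "(vertex_of (tour T (Suc (pos T c))), vertex_of (tour T (pos T h))) \<in> ?L"
      using h on_f pos_less[OF T h(1)] by (intro linked_tour f_edge) (auto, fastforce)
    then show ?thesis
      using tour_pos[OF T h(1)] by simp
  qed
  have outer: "(vertex_of (root M), vertex_of h) \<in> ?L"
    if h: "h \<in> half_edges M" "pos T h \<le> pos T c \<or> pos T d < pos T h" for h
    using h(2)
  proof
    assume "pos T h \<le> pos T c"
    then have "(vertex_of (tour T 0), vertex_of (tour T (pos T h))) \<in> ?L"
      using cd(5) on_f pos_less[OF T h(1)] by (intro linked_tour f_edge) (auto, fastforce)
    then show ?thesis
      using tour_pos[OF T h(1)] by simp
  next
    assume "pos T d < pos T h"
    then have "(vertex_of (tour T (pos T h)), vertex_of (tour T N)) \<in> ?L"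
      using cd(5) on_f pos_less[OF T h(1)] by (intro linked_tour f_edge) (auto, fastforce)
    then show ?thesis
      using tour_pos[OF T h(1)] tour_N[OF T] linked_sym by fastforce
  qed
  have "\<not> spans UG (T - {f}) e"
    using exchange by (rule UG.spanning_tree_not_spans) (use e in auto)
  moreover have "ends UG e = {vertex_of a, vertex_of b}"
    using ends_UG[OF ab(2)] edge_of_eq[OF ab(2)] ab(1,4) by simp
  ultimately have not: "(vertex_of a, vertex_of b) \<notin> ?L"
    by (simp add: spans_iff)
  \<comment> \<open>Since \<open>e\<close> reconnects what removing \<open>f\<close> separates,
    exactly one of \<open>a\<close> and \<open>b\<close> lies on the inner stretch, so the order is
    \<open>a, c, b, d\<close> or \<open>c, a, d, b\<close>.\<close>
  have "\<not> (pos T c < pos T a \<and> pos T b \<le> pos T d)"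
    using inner[of a] inner[of b] ab(2,3,5) not by (meson less_imp_le linked_sym linked_trans order_less_le_trans)
  moreover have "\<not> ((pos T a \<le> pos T c \<or> pos T d < pos T a) \<and> (pos T b \<le> pos T c \<or> pos T d < pos T b))"
    using outer[of a] outer[of b] ab(2,3) not by (meson linked_sym linked_trans)
  moreover have "pos T a \<noteq> pos T c" "pos T a \<noteq> pos T d" "pos T b \<noteq> pos T c" "pos T b \<noteq> pos T d"
    using ne ab(1) cd(1) by auto
  ultimately show "Min (pos T ` e) < Min (pos T ` f) \<longleftrightarrow> Max (pos T ` e) < Max (pos T ` f)"
    unfolding ab(6,7) cd(6,7) using ab(5) cd(5) by linarith
qed

section \<open>Comparison with the embedding activities\<close>

lemma edge_less_iff:
  assumes "e \<in> edges UG" "f \<in> edges UG"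
  shows "edge_less M T e f \<longleftrightarrow> Min (pos T ` e) < Min (pos T ` f)"
proof -
  have "pos T (min_half_edge M T e) = Min (pos T ` e)" if "e \<in> edges UG" for e
    unfolding min_half_edge_def
    using arg_min_if_finite(1)[OF finite_edge[OF that] edge_nonempty[OF that], of "pos T"]
      arg_min_least[OF finite_edge[OF that] edge_nonempty[OF that], of _ "pos T"]
    by (intro Min_eqI[symmetric]) (auto simp: finite_edge[OF that])
  then show ?thesis
    using assms by (simp add: edge_less_def half_edge_less_def)
qed

lemma tour_rank_less_iff:
  assumes "spanning_tree UG T" "e \<in> edges UG" "f \<in> edges UG"
  shows "tour_rank M T f < tour_rank M T e \<longleftrightarrow> Max (pos T ` e) < Max (pos T ` f)"
  using Max_pos_less[OF assms(1,2)] Max_pos_less[OF assms(1,3)] unfolding tour_rank_def by linarith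

text \<open>The other edges of the cocycle are external and exchangeable with \<open>e\<close>, so
  \<open>crossing\<close> turns the comparison of smaller half-edges into that of larger
  ones.\<close>

lemma internal_activity_eq:
  assumes T: "spanning_tree UG T"
  shows "internal_activity M T = card (internally_active UG (tour_rank M) T)"
proof -
  have "minimal_edge_in M T (fundamental_cocycle UG T e) e \<longleftrightarrow>
      (\<forall>f\<in>fundamental_cocycle UG T e. f \<noteq> e \<longrightarrow> tour_rank M T f < tour_rank M T e)" if e: "e \<in> T" for e
  proof -
    have "e \<in> edges UG"
      using T e by (auto simp: spanning_tree_def)
    moreover have "spanning_tree UG (T - {e} \<union> {e})"
      using T e by (simp add: insert_absorb)
    ultimately have "e \<in> fundamental_cocycle UG T e"
      unfolding fundamental_cocycle_def by blast
    moreover have "edge_less M T e f \<longleftrightarrow> tour_rank M T f < tour_rank M T e"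
      if f: "f \<in> fundamental_cocycle UG T e" "f \<noteq> e" for f
    proof -
      have f': "f \<in> edges UG - T" "spanning_tree UG (T - {e} \<union> {f})"
        using f UG.fundamental_cocycle_external[OF T e f] unfolding fundamental_cocycle_def by blast+
      then show ?thesis
        \<comment> \<open>Here \<open>e\<close> is the internal edge of \<open>crossing\<close>, so
          both inequalities come out reversed; the two disequalities from \<open>crossing\<close>
          allow them to be turned around.\<close>
        using crossing[OF T e f'] \<open>e \<in> edges UG\<close> T by (simp add: edge_less_iff tour_rank_less_iff) linarith
    qed
    ultimately show ?thesis
      unfolding minimal_edge_in_def by blast
  qed
  then show ?thesis
    unfolding internal_activity_def internally_active_def by (metis (no_types, lifting))
qed

lemma external_activity_eq:
  assumes T: "spanning_tree UG T"
  shows "external_activity M T = card (externally_active UG (tour_rank M) T)"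
proof -
  have "minimal_edge_in M T (fundamental_cycle UG T e) e \<longleftrightarrow>
      (\<forall>f\<in>fundamental_cycle UG T e. f \<noteq> e \<longrightarrow> tour_rank M T f < tour_rank M T e)" if e: "e \<in> edges UG - T" for e
  proof -
    have "spanning_tree UG (T \<union> {e} - {e})"
      using T e by simp
    then have "e \<in> fundamental_cycle UG T e"
      using e unfolding fundamental_cycle_def by blast
    moreover have "edge_less M T e f \<longleftrightarrow> tour_rank M T f < tour_rank M T e"
      if f: "f \<in> fundamental_cycle UG T e" "f \<noteq> e" for f
    proof -
      have f': "f \<in> T" "f \<in> edges UG"
        using f UG.fundamental_cycle_internal[OF T e f] unfolding fundamental_cycle_def by blast+
      moreover have "T \<union> {e} - {f} = T - {f} \<union> {e}"
        using f by blast
      ultimately have "spanning_tree UG (T - {f} \<union> {e})"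
        using f(1) by (simp add: fundamental_cycle_def)
      then show ?thesis
        using crossing[OF T f'(1) e] e f' T by (simp add: edge_less_iff tour_rank_less_iff)
    qed
    ultimately show ?thesis
      unfolding minimal_edge_in_def by blast
  qed
  then show ?thesis
    unfolding external_activity_def externally_active_def by (metis (no_types, lifting))
qed

theorem tutte_underlying_graph:
  fixes x y :: "'a::comm_ring_1"
  assumes "nc UG (edges UG) = 1"
  shows "tutte UG x y = (\<Sum>T | spanning_tree UG T. x ^ internal_activity M T * y ^ external_activity M T)"
proof -
  interpret tree_order UG "tour_rank M"
    by (rule tree_order)
  show ?thesis
    unfolding tutte_eq_sum_activities[OF assms]
    by (rule sum.cong) (auto simp: internal_activity_eq external_activity_eq)
qed

end

section \<open>Transport along graph isomorphisms\<close>

locale multigraph_iso = G: multigraph G + G': multigraph G'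
  for G :: "('v, 'e) mgraph" and G' :: "('w, 'f) mgraph" +
  fixes \<phi> :: "'v \<Rightarrow> 'w" and \<psi> :: "'e \<Rightarrow> 'f"
  assumes iso: "graph_iso \<phi> \<psi> G G'"
begin

lemma inj_\<phi>: "inj_on \<phi> (verts G)" and \<phi>_verts: "\<phi> ` verts G = verts G'"
  and inj_\<psi>: "inj_on \<psi> (edges G)" and \<psi>_edges: "\<psi> ` edges G = edges G'"
  using iso by (auto simp: graph_iso_def bij_betw_def)

lemma ends_\<psi>: "e \<in> edges G \<Longrightarrow> ends G' (\<psi> e) = \<phi> ` ends G e"
  using iso by (simp add: graph_iso_def)

lemma linked_image:
  assumes "(u, v) \<in> linked G S" "S \<subseteq> edges G"
  shows "(\<phi> u, \<phi> v) \<in> linked G' (\<psi> ` S)"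
  using assms(1) unfolding linked_def[of G]
proof (induction rule: rtrancl_induct)
  case (step v w)
  then obtain e where e: "e \<in> S" "ends G e = {v, w}"
    unfolding adjacency_spanning_subgraph by auto
  then have "ends G' (\<psi> e) = {\<phi> v, \<phi> w}"
    using assms(2) ends_\<psi>[of e] by auto
  then have "(\<phi> v, \<phi> w) \<in> linked G' (\<psi> ` S)"
    using e(1) by (intro linked_edge[of "\<psi> e"]) auto
  with step.IH show ?case
    by (rule linked_trans)
qed simp

text \<open>A path in the image lifts edge by edge: injectivity of \<open>\<phi>\<close> on the
  vertices identifies the end of the lifted edge at which the path has arrived.\<close>

lemma linked_preimage:
  assumes "(\<phi> u, w) \<in> linked G' (\<psi> ` S)" "S \<subseteq> edges G" "u \<in> verts G"
  shows "\<exists>v\<in>verts G. w = \<phi> v \<and> (u, v) \<in> linked G S"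
  using assms(1) unfolding linked_def[of G']
proof (induction rule: rtrancl_induct)
  case base
  show ?case
    using assms(3) by (intro bexI[of _ u]) simp_all
next
  case (step w w')
  then obtain v where v: "v \<in> verts G" "w = \<phi> v" "(u, v) \<in> linked G S"
    by blast
  from step.hyps(2) obtain e where e: "e \<in> S" "ends G' (\<psi> e) = {w, w'}"
    unfolding adjacency_spanning_subgraph by auto
  have "e \<in> edges G"
    using e(1) assms(2) by blast
  then obtain p q where pq: "ends G e = {p, q}" "p \<in> verts G" "q \<in> verts G"
    by (rule G.ends_eq)
  then have "{\<phi> p, \<phi> q} = {\<phi> v, w'}"
    using e(2) v(2) ends_\<psi>[OF \<open>e \<in> edges G\<close>] by simp
  then consider "v = p" "w' = \<phi> q" | "v = q" "w' = \<phi> p"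
    using inj_\<phi> v(1) pq by (auto simp: doubleton_eq_iff dest: inj_onD)
  then show ?case
  proof cases
    case 1
    then have "(u, q) \<in> linked G S"
      using v(3) linked_edge[OF e(1) pq(1)] linked_trans by fast
    with 1 pq show ?thesis
      by blast
  next
    case 2
    then have "(u, p) \<in> linked G S"
      using v(3) linked_sym[OF linked_edge[OF e(1) pq(1)]] linked_trans by fast
    with 2 pq show ?thesis
      by blast
  qed
qed

lemma nc_image:
  assumes "S \<subseteq> edges G"
  shows "nc G' (\<psi> ` S) = nc G S"
proof -
  define C where "C u = {v \<in> verts G. (u, v) \<in> linked G S}" for u
  define C' where "C' u = {v \<in> verts G'. (u, v) \<in> linked G' (\<psi> ` S)}" for u
  have "C' (\<phi> u) = \<phi> ` C u" if u: "u \<in> verts G" for u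
  proof
    show "C' (\<phi> u) \<subseteq> \<phi> ` C u"
      unfolding C_def C'_def using linked_preimage[OF _ assms u] by blast
    show "\<phi> ` C u \<subseteq> C' (\<phi> u)"
      unfolding C_def C'_def using linked_image[OF _ assms] \<phi>_verts by blast
  qed
  then have "C' ` verts G' = (`) \<phi> ` C ` verts G"
    unfolding \<phi>_verts[symmetric] image_image by (rule image_cong[OF refl])
  moreover have "inj_on ((`) \<phi>) (C ` verts G)"
    by (rule inj_on_image) (rule inj_on_subset[OF inj_\<phi>], auto simp: C_def)
  ultimately have "card (C' ` verts G') = card (C ` verts G)"
    by (simp add: card_image)
  then show ?thesis
    unfolding G.nc_eq_UN G'.nc_eq_UN C_def C'_def .
qed

lemma card_image_\<psi>: "S \<subseteq> edges G \<Longrightarrow> card (\<psi> ` S) = card S"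
  using inj_\<psi> by (meson card_image inj_on_subset)

lemma card_verts: "card (verts G') = card (verts G)"
  using card_image[OF inj_\<phi>] \<phi>_verts by simp

lemma bij_\<psi>_Pow: "bij_betw ((`) \<psi>) (Pow (edges G)) (Pow (edges G'))"
  by (rule bij_betw_Pow) (simp add: bij_betw_def inj_\<psi> \<psi>_edges)

lemma tutte_iso: "tutte G' x y = tutte G x y"
proof -
  have "num_components G = nc G (edges G)" "num_components G' = nc G' (edges G')"
    unfolding nc_def spanning_subgraph_def by simp_all
  then have "num_components G' = num_components G"
    using nc_image[of "edges G"] by (simp add: \<psi>_edges)
  then show ?thesis
    unfolding tutte_def nc_def[symmetric] card_verts
    by (subst sum.reindex_bij_betw[OF bij_\<psi>_Pow, symmetric])
      (rule sum.cong, simp_all add: nc_image card_image_\<psi>)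
qed

text \<open>The characterization by cardinalities reduces this to the transport of
  \<open>nc\<close>; no cycles have to be mapped.\<close>

lemma spanning_tree_image: "T \<subseteq> edges G \<Longrightarrow> spanning_tree G' (\<psi> ` T) \<longleftrightarrow> spanning_tree G T"
  unfolding G.spanning_tree_iff_card G'.spanning_tree_iff_card card_verts
  using \<psi>_edges by (auto simp: nc_image card_image_\<psi>)

lemma bij_spanning_trees: "bij_betw ((`) \<psi>) {T. spanning_tree G T} {T. spanning_tree G' T}"
proof -
  have "bij_betw ((`) \<psi>) {T \<in> Pow (edges G). spanning_tree G T} {T \<in> Pow (edges G'). spanning_tree G' T}"
    using bij_\<psi>_Pow by (rule bij_betw_Collect) (simp add: spanning_tree_image)
  moreover have "{T \<in> Pow (edges G). spanning_tree G T} = {T. spanning_tree G T}"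
    "{T \<in> Pow (edges G'). spanning_tree G' T} = {T. spanning_tree G' T}"
    by (auto simp: spanning_tree_def)
  ultimately show ?thesis
    by simp
qed

end

text \<open>The formula is proved for the underlying graph and pulled back: both sides are invariant
  under the isomorphism, and \<open>\<psi>\<close> matches the spanning trees.\<close>

theorem theorem7:
  fixes G :: "('v, 'e) mgraph"
    and M :: "'h rooted_cmap"
    and \<phi> :: "'v \<Rightarrow> 'h set"
    and \<psi> :: "'e \<Rightarrow> 'h set"
    and x y :: "'a::comm_ring_1"
  assumes "multigraph G"
    and "connected_graph G"
    and "edges G \<noteq> {}"
    and "rooted_embedding G M \<phi> \<psi>"
  shows "tutte G x y =
    (\<Sum>T | spanning_tree G T. x ^ internal_activity M (\<psi> ` T) * y ^ external_activity M (\<psi> ` T))"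
proof -
  interpret M: rooted_combinatorial_map M
    using assms(4) by (simp add: rooted_embedding_def)
  interpret multigraph_iso G "underlying_graph M" \<phi> \<psi>
    using assms(1,4) M.multigraph_UG
    by (simp add: rooted_embedding_def multigraph_iso_def multigraph_iso_axioms_def)
  have "connected_graph (spanning_subgraph G (edges G))"
    using assms(2) by (simp add: spanning_subgraph_def)
  then have "nc (underlying_graph M) (edges (underlying_graph M)) = 1"
    using nc_image[of "edges G"] by (simp add: G.connected_iff \<psi>_edges)
  then have "tutte (underlying_graph M) x y = (\<Sum>T | spanning_tree (underlying_graph M) T.
      x ^ internal_activity M T * y ^ external_activity M T)"
    by (rule M.tutte_underlying_graph)
  also have "\<dots> = (\<Sum>T | spanning_tree G T.
      x ^ internal_activity M (\<psi> ` T) * y ^ external_activity M (\<psi> ` T))"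
    by (rule sum.reindex_bij_betw[OF bij_spanning_trees, symmetric])
  finally show ?thesis
    by (simp only: tutte_iso)
qed

end
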